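(* Suppose that $f$ can be written as $$f(x)=\min_{1\le i\le T}\left\{\Psi_i(x)+\tfrac12x^{\top}P_ix+q_i^{\top}x+s_i\right\}$$ for some positive integer $T$, proper closed polyhedral functions $\Psi_i:\mathbb{R}^n\to(-\infty,+\infty]$, symmetric matrices $P_i\in\mathbb{R}^{n\times n}$, $q_i\in\mathbb{R}^n$ and $s_i\in\mathbb{R}$ ($i=1,\dots,T$), that $h$ is a quadratic function, and that one of the following holds: (i) $g$ is a polyhedral function; (ii) $g$ is a positive semidefinite quadratic function, i.e. $g(x)=\frac12x^{\top}Px+q^{\top}x+s$ for some $q\in\mathbb{R}^n$, $s\in\mathbb{R}$ and symmetric positive semidefinite $P\in\mathbb{R}^{n\times n}$. Then $F$ and $Q$ are both KL functions with exponent $\theta=1/2$.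
   Context: Setting. $f,g,h:\mathbb{R}^n\to(-\infty,+\infty]$ are proper lower semicontinuous functions, $\Omega:=\{x\in\mathbb{R}^n: g(x)\neq 0\}$ is nonempty, and $f$ is block-separable: $f(x)=\sum_{i=1}^N f_i(x_i)$, where the subvectors $x_i\in\mathbb{R}^{n_i}$ form a partition of the components of $x$ and each $f_i:\mathbb{R}^{n_i}\to(-\infty,+\infty]$ is proper lower semicontinuous. Standing assumptions: (a) $f$ is continuous on $\mathrm{dom}(f)$ and each $f_i$ is bounded below; (b) $h$ is locally Lipschitz differentiable on $\Omega$, i.e. every $x\in\Omega$ has a neighborhood $\mathcal{B}(x)$ and a constant $L_x$ with $\|\nabla h(u)-\nabla h(v)\|_2\le L_x\|u-v\|_2$ for all $u,v\in\mathcal{B}(x)\cap\Omega$; (c) $g$ is convex, real-valued and nonnegative on $\mathbb{R}^n$; (d) $f+h\ge 0$ on $\mathrm{dom}(f)$. The problem of minimizing $F$ (below) is feasible, i.e. $\Omega\cap\mathrm{dom}(f)\ne\emptyset$. Notation. $\mathrm{dom}(\varphi)=\{x:\varphi(x)<+\infty\}$; $g^*(y)=\sup_x\{\langle x,y\rangle-g(x)\}$; $\zeta(x):=f(x)+h(x)$; $\eta(x,y):=\langle x,y\rangle-g^*(y)$. $F(x)=\zeta(x)/g(x)$ if $x\in\Omega\cap\mathrm{dom}(f)$ and $F(x)=+\infty$ otherwise. $Q(x,y)=\zeta(x)/\eta(x,y)$ if $(x,y)\in\mathrm{dom}(f)\times\mathrm{dom}(g^* )$ and $\eta(x,y)>0$,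 and $Q(x,y)=+\infty$ otherwise. A function is polyhedral if its epigraph is a polyhedral set (a finite intersection of closed half-spaces). Subdifferentials. For a proper $\varphi$ and $x\in\mathrm{dom}(\varphi)$: $\widehat{\partial}\varphi(x)=\{y:\liminf_{z\to x,z\ne x}\frac{\varphi(z)-\varphi(x)-\langle y,z-x\rangle}{\|z-x\|_2}\ge 0\}$ (Fréchet), $\partial\varphi(x)=\{y:\exists x^k\to x,\ \varphi(x^k)\to\varphi(x),\ y^k\in\widehat{\partial}\varphi(x^k),\ y^k\to y\}$ (limiting). $\mathrm{dom}(\partial\varphi)=\{x\in\mathrm{dom}(\varphi):\partial\varphi(x)\ne\emptyset\}$. $\mathrm{dist}(0,\emptyset)=+\infty$. KL functions. A proper $\varphi$ satisfies the KL property with exponent $\theta\in[0,1)$ at $x\in\mathrm{dom}(\partial\varphi)$ if there exist $\epsilon\in(0,+\infty]$, $\delta>0$ and $a_0>0$ such that, with $\phi(s)=a_0s^{1-\theta}$, one has $\phi'(\varphi(z)-\varphi(x))\,\mathrm{dist}(0,\partial\varphi(z))\ge1$ for all $z$ with $\|z-x\|_2<\delta$ and $\varphi(x)<\varphi(z)<\varphi(x)+\epsilon$. $\varphi$ is a KL function with exponent $\theta$ if it is proper and satisfies this at every point of $\mathrm{dom}(\partial\varphi)$. *)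

theory Defs
  imports "HOL-Analysis.Analysis"
begin

text \<open>
  Functions into \<open>(-\<infinity>,+\<infinity>]\<close> are modelled as \<^typ>\<open>ereal\<close>-valued functions; \<open>proper_on\<close> excludes the
  value \<open>-\<infinity>\<close>.
\<close>

definition effdom :: "('a \<Rightarrow> ereal) \<Rightarrow> 'a set" where
  "effdom \<phi> = {x. \<phi> x < \<infinity>}"

definition proper_on :: "'a set \<Rightarrow> ('a \<Rightarrow> ereal) \<Rightarrow> bool" where
  "proper_on S \<phi> \<longleftrightarrow> (\<forall>x\<in>S. \<phi> x \<noteq> -\<infinity>) \<and> (\<exists>x\<in>S. \<phi> x < \<infinity>)"

abbreviation proper :: "('a \<Rightarrow> ereal) \<Rightarrow> bool" where
  "proper \<equiv> proper_on UNIV"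

definition lsc_on :: "'a::topological_space set \<Rightarrow> ('a \<Rightarrow> ereal) \<Rightarrow> bool" where
  "lsc_on S \<phi> \<longleftrightarrow> (\<forall>x\<in>S. \<phi> x \<le> Liminf (at x within S) \<phi>)"

abbreviation lsc :: "('a::topological_space \<Rightarrow> ereal) \<Rightarrow> bool" where
  "lsc \<equiv> lsc_on UNIV"

definition epi :: "('a \<Rightarrow> ereal) \<Rightarrow> ('a \<times> real) set" where
  "epi \<phi> = {(x, t). \<phi> x \<le> ereal t}"

definition polyhedral_function :: "('a::euclidean_space \<Rightarrow> ereal) \<Rightarrow> bool" where
  "polyhedral_function \<phi> \<longleftrightarrow> polyhedron (epi \<phi>)"

definition conjugate :: "('a::real_inner \<Rightarrow> ereal) \<Rightarrow> 'a \<Rightarrow> ereal" where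
  "conjugate g y = (SUP x. ereal (x \<bullet> y) - g x)"

text \<open>
  The subvector space belonging to an index block \<open>B\<close> is represented by the coordinate
  subspace \<open>block_space B\<close>, which is isometric to \<open>\<real>\<^sup>k\<close> with \<open>k = card B\<close>. Only the values
  of a block function on this subspace are relevant.
\<close>

definition block_space :: "'n set \<Rightarrow> (real ^ 'n) set" where
  "block_space B = {x. \<forall>j. j \<notin> B \<longrightarrow> x $ j = 0}"

definition subvector :: "'n set \<Rightarrow> real ^ 'n \<Rightarrow> real ^ 'n" where
  "subvector B x = (\<chi> j. if j \<in> B then x $ j else 0)"

definition block_separable ::
  "nat \<Rightarrow> (nat \<Rightarrow> 'n::finite set) \<Rightarrow> (nat \<Rightarrow> real ^ 'n \<Rightarrow> ereal) \<Rightarrow> (real ^ 'n \<Rightarrow> ereal) \<Rightarrow> bool" where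
  "block_separable N B fs f \<longleftrightarrow>
     (\<Union>i\<in>{1..N}. B i) = UNIV \<and> disjoint_family_on B {1..N} \<and> (\<forall>i\<in>{1..N}. B i \<noteq> {}) \<and>
     (\<forall>i\<in>{1..N}. proper_on (block_space (B i)) (fs i) \<and> lsc_on (block_space (B i)) (fs i)) \<and>
     (\<forall>x. f x = (\<Sum>i=1..N. fs i (subvector (B i) x)))"

definition has_gradient :: "('a::real_inner \<Rightarrow> ereal) \<Rightarrow> 'a \<Rightarrow> 'a \<Rightarrow> bool" where
  "has_gradient \<phi> v x \<longleftrightarrow>
     (\<forall>\<^sub>F u in nhds x. \<bar>\<phi> u\<bar> \<noteq> \<infinity>) \<and> GDERIV (\<lambda>u. real_of_ereal (\<phi> u)) x :> v"

definition locally_lipschitz_differentiable_on ::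
  "('a::real_inner \<Rightarrow> ereal) \<Rightarrow> 'a set \<Rightarrow> bool" where
  "locally_lipschitz_differentiable_on \<phi> S \<longleftrightarrow>
     (\<exists>G. (\<forall>x\<in>S. has_gradient \<phi> (G x) x) \<and>
          (\<forall>x\<in>S. \<exists>U L. open U \<and> x \<in> U \<and>
             (\<forall>u\<in>U \<inter> S. \<forall>v\<in>U \<inter> S. norm (G u - G v) \<le> L * norm (u - v))))"

definition quadratic_form :: "real ^ 'n ^ 'n \<Rightarrow> real ^ 'n \<Rightarrow> real \<Rightarrow> real ^ 'n \<Rightarrow> real" where
  "quadratic_form P q s x = 1/2 * (x \<bullet> (P *v x)) + q \<bullet> x + s"

definition symmetric :: "real ^ 'n ^ 'n \<Rightarrow> bool" where
  "symmetric P \<longleftrightarrow> transpose P = P"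

definition quadratic_function :: "(real ^ 'n::finite \<Rightarrow> ereal) \<Rightarrow> bool" where
  "quadratic_function \<phi> \<longleftrightarrow>
     (\<exists>P q s. symmetric P \<and> (\<forall>x. \<phi> x = ereal (quadratic_form P q s x)))"

definition psd_quadratic_function :: "(real ^ 'n::finite \<Rightarrow> ereal) \<Rightarrow> bool" where
  "psd_quadratic_function \<phi> \<longleftrightarrow>
     (\<exists>P q s. symmetric P \<and> (\<forall>x. 0 \<le> x \<bullet> (P *v x)) \<and>
        (\<forall>x. \<phi> x = ereal (quadratic_form P q s x)))"

definition zeta :: "('a \<Rightarrow> ereal) \<Rightarrow> ('a \<Rightarrow> ereal) \<Rightarrow> 'a \<Rightarrow> ereal" where
  "zeta f h x = f x + h x"

definition eta :: "('a::real_inner \<Rightarrow> ereal) \<Rightarrow> 'a \<Rightarrow> 'a \<Rightarrow> ereal" where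
  "eta g x y = ereal (x \<bullet> y) - conjugate g y"

definition Omega :: "('a \<Rightarrow> ereal) \<Rightarrow> 'a set" where
  "Omega g = {x. g x \<noteq> 0}"

definition F_obj :: "('a \<Rightarrow> ereal) \<Rightarrow> ('a \<Rightarrow> ereal) \<Rightarrow> ('a \<Rightarrow> ereal) \<Rightarrow> 'a \<Rightarrow> ereal" where
  "F_obj f g h x = (if x \<in> Omega g \<inter> effdom f then zeta f h x / g x else \<infinity>)"

definition Q_obj ::
  "('a::real_inner \<Rightarrow> ereal) \<Rightarrow> ('a \<Rightarrow> ereal) \<Rightarrow> ('a \<Rightarrow> ereal) \<Rightarrow> 'a \<times> 'a \<Rightarrow> ereal" where
  "Q_obj f g h = (\<lambda>(x, y).
     if (x, y) \<in> effdom f \<times> effdom (conjugate g) \<and> eta g x y > 0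
     then zeta f h x / eta g x y else \<infinity>)"

definition frechet_subdifferential :: "('a::real_inner \<Rightarrow> ereal) \<Rightarrow> 'a \<Rightarrow> 'a set" where
  "frechet_subdifferential \<phi> x = {y. x \<in> effdom \<phi> \<and>
     0 \<le> Liminf (at x) (\<lambda>z. (\<phi> z - \<phi> x - ereal (y \<bullet> (z - x))) / ereal (norm (z - x)))}"

definition limiting_subdifferential :: "('a::real_inner \<Rightarrow> ereal) \<Rightarrow> 'a \<Rightarrow> 'a set" where
  "limiting_subdifferential \<phi> x = {y. x \<in> effdom \<phi> \<and>
     (\<exists>xs ys. xs \<longlonglongrightarrow> x \<and> (\<lambda>k. \<phi> (xs k)) \<longlonglongrightarrow> \<phi> x \<and>
        (\<forall>k. ys k \<in> frechet_subdifferential \<phi> (xs k)) \<and> ys \<longlonglongrightarrow> y)}"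

definition dom_subdifferential :: "('a::real_inner \<Rightarrow> ereal) \<Rightarrow> 'a set" where
  "dom_subdifferential \<phi> = {x \<in> effdom \<phi>. limiting_subdifferential \<phi> x \<noteq> {}}"

text \<open>Unlike \<^const>\<open>infdist\<close>, this distance is \<open>+\<infinity>\<close> for the empty set.\<close>

definition dist_zero :: "'a::real_normed_vector set \<Rightarrow> ereal" where
  "dist_zero S = (INF v\<in>S. ereal (norm v))"

text \<open>
  In the inequality below \<open>\<phi> z - \<phi> x\<close> is a positive real number, so \<^const>\<open>real_of_ereal\<close> loses
  nothing and the derivative of the desingularizing function exists there.
\<close>

definition KL_property_at :: "('a::real_inner \<Rightarrow> ereal) \<Rightarrow> real \<Rightarrow> 'a \<Rightarrow> bool" where
  "KL_property_at \<phi> \<theta> x \<longleftrightarrow>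
     (\<exists>(\<epsilon>::ereal) (\<delta>::real) (a\<^sub>0::real). 0 < \<epsilon> \<and> 0 < \<delta> \<and> 0 < a\<^sub>0 \<and>
        (\<forall>z. norm (z - x) < \<delta> \<and> \<phi> x < \<phi> z \<and> \<phi> z < \<phi> x + \<epsilon> \<longrightarrow>
           1 \<le> ereal (deriv (\<lambda>s. a\<^sub>0 * s powr (1 - \<theta>)) (real_of_ereal (\<phi> z - \<phi> x)))
                * dist_zero (limiting_subdifferential \<phi> z)))"

definition KL_function :: "('a::real_inner \<Rightarrow> ereal) \<Rightarrow> real \<Rightarrow> bool" where
  "KL_function \<phi> \<theta> \<longleftrightarrow>
     0 \<le> \<theta> \<and> \<theta> < 1 \<and> proper \<phi> \<and> (\<forall>x\<in>dom_subdifferential \<phi>. KL_property_at \<phi> \<theta> x)"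

end

theory Submission
  imports Defs
begin

text \<open>
  Near a reference point, each of \<open>F\<close> and \<open>Q\<close> is a minimum of finitely many quotients \<open>p / d\<close> of
  quadratic functions, each restricted to a polyhedron. For \<open>Q\<close> this needs that the conjugate of \<open>g\<close>
  is again piecewise quadratic on polyhedra. A Frechet subgradient \<open>u\<close> at a point \<open>x\<close> with value
  \<open>c'\<close> on the piece \<open>p / d\<close> satisfies \<open>\<nabla>p - c' \<nabla>d = d u\<close> along the face of \<open>x\<close>. With the reference
  value \<open>c\<close>, the function \<open>p - c d\<close> is quadratic and vanishes at the reference point, so on each face
  its value \<open>(c' - c) d\<close> is bounded by a multiple of its squared gradient along the face, that is, of
  \<open>\<parallel>(c' - c) \<nabla>d + d u\<parallel>\<^sup>2\<close>. For \<open>c'\<close> close to \<open>c\<close> the term \<open>(c' - c) \<nabla>d\<close> is absorbed on the left, and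
  \<open>c' - c\<close> is bounded by a multiple of \<open>\<parallel>u\<parallel>\<^sup>2\<close>.
\<close>

section \<open>Quadratic functions on polyhedra\<close>

text \<open>The Hessian of \<open>p - c d\<close> may be indefinite and singular along a face, so a
  small gradient does not bound the displacement \<open>w\<close> from the reference point. It does
  bound the value: for self-adjoint \<open>H\<close>, \<open>w \<bullet> H w\<close> depends only on
  the projection of \<open>H w\<close> onto the directions of the face, and a preimage of controlled
  length can replace \<open>w\<close>.

  Faces enter only through lines that are feasible in both directions. Tested on such a direction
  and on its negative, a Frechet subgradient yields an equation, which takes the place of normal
  cones and of sum and quotient rules for subdifferentials. Where several pieces are active, each
  lies above the function and touches it, so the subgradient satisfies the equation of every one of
  them.

  Neighbourhoods are taken jointly in the point and in the value. This matches the two conditions in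
  the KL property, and it discards a piece whose value at the reference point exceeds
  \<open>c\<close>. Finitely many faces and pieces make the constants uniform.\<close>

definition quadratic_expansion ::
  "('a::euclidean_space \<Rightarrow> real) \<Rightarrow> ('a \<Rightarrow> 'a) \<Rightarrow> ('a \<Rightarrow> 'a) \<Rightarrow> bool" where
  "quadratic_expansion q G H \<longleftrightarrow> linear H \<and> (\<forall>x y. H x \<bullet> y = x \<bullet> H y) \<and>
     (\<forall>x w. q (x + w) = q x + G x \<bullet> w + (w \<bullet> H w) / 2) \<and> (\<forall>x w. G (x + w) = G x + H w)"

text \<open>\<open>A\<close> ranges over all linear maps, not only self-adjoint ones. Sums and
  affine substitutions then stay in this form at once, and the pairing in \<open>eta\<close> is
  covered too; \<open>A + adjoint A\<close> recovers the Hessian.\<close>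

definition quadratic :: "('a::euclidean_space \<Rightarrow> real) \<Rightarrow> bool" where
  "quadratic q \<longleftrightarrow> (\<exists>A b e. linear A \<and> (\<forall>x. q x = x \<bullet> A x + b \<bullet> x + e))"

lemma quadraticE:
  assumes "quadratic q"
  obtains A b e where "linear A" "\<And>x. q x = x \<bullet> A x + b \<bullet> x + e"
proof -
  from assms obtain A b e where "linear A \<and> (\<forall>x. q x = x \<bullet> A x + b \<bullet> x + e)"
    unfolding quadratic_def by (elim exE)
  then show thesis by (intro that[of A b e]) (elim conjE, assumption, elim conjE, erule spec)
qed

lemma quadratic_expansionD:
  assumes "quadratic_expansion q G H"
  shows "linear H" "H x \<bullet> y = x \<bullet> H y" "q (x + w) = q x + G x \<bullet> w + (w \<bullet> H w) / 2"
    "G (x + w) = G x + H w"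
  by (insert assms[unfolded quadratic_expansion_def], elim conjE, (assumption | erule spec | (erule allE)+, assumption))+

lemma quadratic_expansion_exists:
  assumes "quadratic q"
  obtains G H where "quadratic_expansion q G H"
proof -
  obtain A b e where A: "linear A" and q: "\<And>x. q x = x \<bullet> A x + b \<bullet> x + e"
    by (rule quadraticE[OF assms]) (rule that)
  note adj = adjoint_works[OF A]
  have adj': "adjoint A x \<bullet> y = A y \<bullet> x" for x y
    by (metis adj inner_commute)
  have "quadratic_expansion q (\<lambda>x. A x + adjoint A x + b) (\<lambda>x. A x + adjoint A x)"
    unfolding quadratic_expansion_def
  proof (intro conjI allI)
    show "linear (\<lambda>x. A x + adjoint A x)"
      using A adjoint_linear[OF A] by (rule linear_compose_add)
    show "(A x + adjoint A x) \<bullet> y = x \<bullet> (A y + adjoint A y)" for x y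
      by (simp add: inner_add adj adj' inner_commute)
    show "q (x + w) = q x + (A x + adjoint A x + b) \<bullet> w + w \<bullet> (A w + adjoint A w) / 2" for x w
      by (simp add: q inner_add linear_add[OF A] adj adj' inner_commute algebra_simps)
    show "A (x + w) + adjoint A (x + w) + b = A x + adjoint A x + b + (A w + adjoint A w)" for x w
      by (simp add: linear_add[OF A] linear_add[OF adjoint_linear[OF A]])
  qed
  then show thesis ..
qed

section \<open>Closure properties of quadratic functions\<close>

lemma quadratic_inner_linear: "linear A \<Longrightarrow> quadratic (\<lambda>x. x \<bullet> A x)"
  unfolding quadratic_def by (intro exI[of _ A] exI[of _ 0]) auto

lemma quadratic_affine: "quadratic (\<lambda>x. b \<bullet> x + e)"
  unfolding quadratic_def by (intro exI[of _ "\<lambda>x. 0"] exI[of _ b] exI[of _ e]) (auto simp: linear_zero)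

lemma quadratic_add:
  assumes "quadratic p" "quadratic q"
  shows "quadratic (\<lambda>x. p x + q x)"
proof -
  obtain A b e where "linear A" "\<And>x. p x = x \<bullet> A x + b \<bullet> x + e"
    by (rule quadraticE[OF assms(1)]) (rule that)
  moreover obtain A' b' e' where "linear A'" "\<And>x. q x = x \<bullet> A' x + b' \<bullet> x + e'"
    by (rule quadraticE[OF assms(2)]) (rule that)
  ultimately show ?thesis
    unfolding quadratic_def
    by (intro exI[of _ "\<lambda>x. A x + A' x"] exI[of _ "b + b'"] exI[of _ "e + e'"])
      (simp add: linear_compose_add inner_add)
qed

lemma quadratic_scale:
  assumes "quadratic q"
  shows "quadratic (\<lambda>x. k * q x)"
proof -
  obtain A b e where "linear A" "\<And>x. q x = x \<bullet> A x + b \<bullet> x + e"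
    by (rule quadraticE[OF assms]) (rule that)
  then show ?thesis
    unfolding quadratic_def
    by (intro exI[of _ "\<lambda>x. k *\<^sub>R A x"] exI[of _ "k *\<^sub>R b"] exI[of _ "k * e"])
      (simp add: linear_compose_scale_right algebra_simps)
qed

lemma quadratic_diff: "quadratic p \<Longrightarrow> quadratic q \<Longrightarrow> quadratic (\<lambda>x. p x - q x)"
  using quadratic_add[of p "\<lambda>x. - 1 * q x"] quadratic_scale[of q "-1"] by simp

lemma quadratic_compose_affine:
  fixes L :: "'a::euclidean_space \<Rightarrow> 'b::euclidean_space"
  assumes "quadratic q" and L: "linear L"
  shows "quadratic (\<lambda>x. q (L x + k))"
proof -
  obtain A b e where A: "linear A" "\<And>x. q x = x \<bullet> A x + b \<bullet> x + e"
    by (rule quadraticE[OF assms(1)]) (rule that)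
  have "linear (adjoint L \<circ> (A \<circ> L))"
    using A(1) L adjoint_linear[OF L] by (intro linear_compose)
  moreover have "q (L x + k) = x \<bullet> (adjoint L \<circ> (A \<circ> L)) x
      + adjoint L (adjoint A k + A k + b) \<bullet> x + (k \<bullet> A k + b \<bullet> k + e)" for x
    unfolding A(2) comp_def adjoint_works[OF L] adjoint_clauses(2)[OF L]
    by (simp add: linear_add[OF A(1)] inner_add adjoint_works[OF A(1)] inner_commute)
  ultimately show ?thesis
    unfolding quadratic_def by blast
qed

lemma quadratic_compose_linear: "quadratic q \<Longrightarrow> linear L \<Longrightarrow> quadratic (\<lambda>x. q (L x))"
  using quadratic_compose_affine[of q L 0] by simp

text \<open>Meant for \<open>k\<close> the reference value \<open>c\<close>: where the denominator
  is nonzero, the quotient equals \<open>c\<close> exactly when this combination vanishes.\<close>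

lemma quadratic_expansion_diff_scale:
  assumes "quadratic_expansion p G H" "quadratic_expansion q G' H'"
  shows "quadratic_expansion (\<lambda>x. p x - k * q x) (\<lambda>x. G x - k *\<^sub>R G' x) (\<lambda>x. H x - k *\<^sub>R H' x)"
  using assms unfolding quadratic_expansion_def
  by (auto simp: linear_compose_sub linear_compose_scale_right inner_diff algebra_simps
      diff_divide_distrib)

lemma quadratic_expansion_continuous:
  assumes "quadratic_expansion q G H"
  shows "(q \<longlongrightarrow> q x) (nhds x)" and "(G \<longlongrightarrow> G x) (nhds x)"
proof -
  have H: "linear H" and q: "\<And>w. q (x + w) = q x + G x \<bullet> w + (w \<bullet> H w) / 2"
    and G: "\<And>w. G (x + w) = G x + H w"
    by (rule quadratic_expansionD[OF assms])+
  have "bounded_linear H" using H by (simp add: linear_conv_bounded_linear)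
  then have lim: "((\<lambda>y. H (y - x)) \<longlongrightarrow> H (x - x)) (nhds x)"
    by (rule bounded_linear.tendsto) (intro tendsto_intros filterlim_ident)
  have G': "G = (\<lambda>y. G x + H (y - x))"
    using G[of "y - x" for y] by (intro ext) (metis add.commute diff_add_cancel)
  have "((\<lambda>y. G x + H (y - x)) \<longlongrightarrow> G x + H (x - x)) (nhds x)"
    by (intro tendsto_intros lim)
  then show "(G \<longlongrightarrow> G x) (nhds x)" unfolding G'[symmetric] by (simp add: linear_0[OF H])
  have q': "q = (\<lambda>y. q x + G x \<bullet> (y - x) + ((y - x) \<bullet> H (y - x)) / 2)"
    using q[of "y - x" for y] by (intro ext) (metis add.commute diff_add_cancel)
  have "((\<lambda>y. q x + G x \<bullet> (y - x) + ((y - x) \<bullet> H (y - x)) / 2) \<longlongrightarrow>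
      q x + G x \<bullet> (x - x) + ((x - x) \<bullet> H (x - x)) / 2) (nhds x)"
    by (intro tendsto_intros lim filterlim_ident) auto
  then show "(q \<longlongrightarrow> q x) (nhds x)" unfolding q'[symmetric] by simp
qed

section \<open>Quadratic growth along a subspace\<close>

lemma orthogonal_projection_exists:
  fixes L :: "'a::euclidean_space set"
  assumes "subspace L"
  obtains P where "linear P" "\<And>x. P x \<in> L" "\<And>x y. y \<in> L \<Longrightarrow> P x \<bullet> y = x \<bullet> y"
proof -
  obtain B where B: "pairwise orthogonal B" "independent B" "span B = L"
    using orthonormal_basis_subspace[OF assms] by metis
  define P where "P x = (\<Sum>b\<in>B. (b \<bullet> x / (b \<bullet> b)) *\<^sub>R b)" for x
  have "linear P"
    unfolding P_def by (intro linear_compose_sum ballI linearI)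
      (auto simp: inner_add add_divide_distrib algebra_simps)
  moreover have "P x \<in> L" for x
    unfolding P_def B(3)[symmetric] by (intro span_sum span_mul span_base)
  moreover have "P x \<bullet> y = x \<bullet> y" if "y \<in> L" for x y
  proof -
    have "orthogonal y (x - P x)"
      unfolding P_def using B that by (intro Gram_Schmidt_step) auto
    then show ?thesis by (simp add: orthogonal_def inner_diff inner_commute)
  qed
  ultimately show thesis using that by blast
qed

text \<open>With \<open>P\<close> the projection onto \<open>L\<close>, the map
  \<open>P \<circ> H\<close> may have a kernel in \<open>L\<close>, so \<open>w\<close> cannot be
  bounded by \<open>u\<close>. By self-adjointness \<open>w \<bullet> H w = w' \<bullet> H w\<close>
  for every \<open>w'\<close> in \<open>L\<close> with the same image under
  \<open>P \<circ> H\<close>. A fixed linear right inverse supplies such a \<open>w'\<close> whose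
  length is controlled by that image, hence by \<open>u\<close>.\<close>

lemma selfadjoint_subspace_bound:
  fixes H :: "'a::euclidean_space \<Rightarrow> 'a"
  assumes H: "linear H" and sym: "\<And>x y. H x \<bullet> y = x \<bullet> H y" and L: "subspace L"
  obtains C where "0 < C"
    "\<And>w u. w \<in> L \<Longrightarrow> (\<And>\<theta>. \<theta> \<in> L \<Longrightarrow> H w \<bullet> \<theta> = u \<bullet> \<theta>) \<Longrightarrow> w \<bullet> H w \<le> C * (norm u)\<^sup>2"
proof -
  obtain P where P: "linear P" "\<And>x. P x \<in> L" "\<And>x y. y \<in> L \<Longrightarrow> P x \<bullet> y = x \<bullet> y"
    using orthogonal_projection_exists[OF L] by metis
  have lin: "linear (P \<circ> H)" using H P(1) by (rule linear_compose)
  obtain M where M: "range M \<subseteq> L" "linear M" "\<And>v. v \<in> (P \<circ> H) ` L \<Longrightarrow> (P \<circ> H) (M v) = v"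
    using linear_exists_right_inverse_on[OF lin L] by auto
  obtain C where C: "0 < C" "\<And>x. norm (M x) \<le> C * norm x"
    using linear_bounded_pos[OF M(2)] by metis
  show thesis
  proof (rule that[OF C(1)])
    fix w u assume w: "w \<in> L" and u: "\<And>\<theta>. \<theta> \<in> L \<Longrightarrow> H w \<bullet> \<theta> = u \<bullet> \<theta>"
    define v where "v = P (H w)"
    define w' where "w' = M v"
    have w': "w' \<in> L" "P (H w') = v"
      using M(1) M(3)[of v] w unfolding w'_def v_def by auto
    have "w \<bullet> H w = P (H w) \<bullet> w" using P(3)[OF w] by (simp add: inner_commute)
    also have "\<dots> = H w' \<bullet> w" using w'(2) P(3)[OF w, of "H w'"] unfolding v_def by simp
    also have "\<dots> = u \<bullet> w'" using sym u[OF w'(1)] by (metis inner_commute)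
    also have "\<dots> \<le> norm u * norm w'" by (rule norm_cauchy_schwarz)
    also have "\<dots> \<le> norm u * (C * norm v)" unfolding w'_def by (intro mult_left_mono C) auto
    finally have 1: "w \<bullet> H w \<le> norm u * (C * norm v)" .
    \<comment> \<open>\<open>v\<close> is the projection of \<open>u\<close> onto \<open>L\<close>,
      hence no longer than \<open>u\<close>.\<close>
    have "v \<bullet> v = u \<bullet> v" using P(2,3) u unfolding v_def by metis
    also have "\<dots> \<le> norm u * norm v" by (rule norm_cauchy_schwarz)
    finally have "norm v * norm v \<le> norm u * norm v" by (simp add: dot_square_norm power2_eq_square)
    then have "norm v \<le> norm u" by (cases "norm v = 0") auto
    then have "norm u * (C * norm v) \<le> norm u * (C * norm u)" using C by (intro mult_left_mono) auto
    then show "w \<bullet> H w \<le> C * (norm u)\<^sup>2" using 1 by (simp add: power2_eq_square algebra_simps)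
  qed
qed

text \<open>Either the gradient at the reference point has a component along the subspace, and then
  \<open>u\<close> is bounded away from zero, or the value gap is a pure quadratic form.\<close>

lemma quadratic_subspace_growth:
  assumes q: "quadratic_expansion q G H" and L: "subspace L"
  shows "\<exists>C\<ge>0. \<forall>\<^sub>F x in nhds x\<^sub>0. \<forall>u. x - x\<^sub>0 \<in> L \<longrightarrow> (\<forall>\<theta>\<in>L. (G x - u) \<bullet> \<theta> = 0) \<longrightarrow>
           q x - q x\<^sub>0 \<le> C * (norm u)\<^sup>2"
proof -
  have H: "linear H" "\<And>x y. H x \<bullet> y = x \<bullet> H y"
    and exp: "\<And>x w. q (x + w) = q x + G x \<bullet> w + (w \<bullet> H w) / 2" "\<And>x w. G (x + w) = G x + H w"
    by (rule quadratic_expansionD[OF q])+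
  show ?thesis
  proof (cases "\<forall>\<theta>\<in>L. G x\<^sub>0 \<bullet> \<theta> = 0")
    case True
    obtain C where C: "0 < C"
      "\<And>w u. w \<in> L \<Longrightarrow> (\<And>\<theta>. \<theta> \<in> L \<Longrightarrow> H w \<bullet> \<theta> = u \<bullet> \<theta>) \<Longrightarrow> w \<bullet> H w \<le> C * (norm u)\<^sup>2"
      using selfadjoint_subspace_bound[OF H L] by metis
    have "q x - q x\<^sub>0 \<le> C * (norm u)\<^sup>2"
      if x: "x - x\<^sub>0 \<in> L" and u: "\<forall>\<theta>\<in>L. (G x - u) \<bullet> \<theta> = 0" for x u
    proof -
      define w where "w = x - x\<^sub>0"
      have w: "x = x\<^sub>0 + w" "w \<in> L" using x by (auto simp: w_def)
      \<comment> \<open>\<open>H w\<close> is the increment of the gradient from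
        \<open>x\<^sub>0\<close> to \<open>x\<close>, and in this case the gradient at
        \<open>x\<^sub>0\<close> vanishes on \<open>L\<close>.\<close>
      have "H w \<bullet> \<theta> = u \<bullet> \<theta>" if "\<theta> \<in> L" for \<theta>
        using u[rule_format, OF that] True that by (simp add: w exp inner_diff inner_add)
      then have "w \<bullet> H w \<le> C * (norm u)\<^sup>2" using C w by blast
      moreover have "0 \<le> C * (norm u)\<^sup>2" using C by simp
      moreover have "q x - q x\<^sub>0 = (w \<bullet> H w) / 2" using True w by (simp add: exp)
      ultimately show ?thesis by linarith
    qed
    then show ?thesis using C(1) by (intro exI[of _ C]) (auto intro!: always_eventually)
  next
    case False
    then obtain \<theta> where \<theta>: "\<theta> \<in> L" "G x\<^sub>0 \<bullet> \<theta> \<noteq> 0" by blast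
    define \<kappa> where "\<kappa> = \<bar>G x\<^sub>0 \<bullet> \<theta>\<bar> / 2"
    have \<kappa>: "0 < \<kappa>" "norm \<theta> > 0" using \<theta> by (auto simp: \<kappa>_def)
    have "((\<lambda>x. \<bar>G x \<bullet> \<theta>\<bar>) \<longlongrightarrow> \<bar>G x\<^sub>0 \<bullet> \<theta>\<bar>) (nhds x\<^sub>0)"
      by (intro tendsto_intros quadratic_expansion_continuous[OF q])
    then have ev1: "\<forall>\<^sub>F x in nhds x\<^sub>0. \<kappa> < \<bar>G x \<bullet> \<theta>\<bar>"
      by (rule order_tendstoD) (use \<kappa> in \<open>simp add: \<kappa>_def\<close>)
    have ev2: "\<forall>\<^sub>F x in nhds x\<^sub>0. q x < q x\<^sub>0 + 1"
      by (rule order_tendstoD[OF quadratic_expansion_continuous(1)[OF q]]) simp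
    \<comment> \<open>Stationarity forces \<open>\<kappa> \<le> norm u * norm \<theta>\<close>, so
      this \<open>C\<close> makes \<open>C * (norm u)\<^sup>2\<close> at least 1, while
      \<open>ev2\<close> keeps the value gap below 1.\<close>
    define C where "C = (norm \<theta> / \<kappa>)\<^sup>2"
    have "q x - q x\<^sub>0 \<le> C * (norm u)\<^sup>2"
      if "\<kappa> < \<bar>G x \<bullet> \<theta>\<bar>" "q x < q x\<^sub>0 + 1" and u: "\<forall>\<theta>\<in>L. (G x - u) \<bullet> \<theta> = 0" for x u
    proof -
      have "G x \<bullet> \<theta> = u \<bullet> \<theta>" using u \<theta> by (auto simp: inner_diff)
      then have "\<kappa> \<le> norm u * norm \<theta>" using that(1) Cauchy_Schwarz_ineq2[of u \<theta>] by linarith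
      then have "1 \<le> norm \<theta> / \<kappa> * norm u" using \<kappa> by (simp add: field_simps)
      then have "1 \<le> (norm \<theta> / \<kappa> * norm u)\<^sup>2" by (rule one_le_power)
      then have "1 \<le> C * (norm u)\<^sup>2" by (simp only: C_def power_mult_distrib)
      then show ?thesis using that(2) by linarith
    qed
    then show ?thesis
      by (intro exI[of _ C] conjI eventually_mono[OF eventually_conj[OF ev1 ev2]])
        (auto simp: C_def)
  qed
qed

text \<open>The sum of the individual constants dominates each of them, because all are nonnegative.
  It serves once for the faces of a polyhedron and once for the pairs of pieces.\<close>

lemma eventually_uniform_constant:
  fixes R :: "'a \<Rightarrow> real \<Rightarrow> 'b \<Rightarrow> bool"
  assumes "finite A" and ex: "\<And>a. a \<in> A \<Longrightarrow> \<exists>C\<ge>0. \<forall>\<^sub>F p in F. R a C p"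
    and mono: "\<And>a C C' p. R a C p \<Longrightarrow> C \<le> C' \<Longrightarrow> R a C' p"
  shows "\<exists>C\<ge>0. \<forall>\<^sub>F p in F. \<forall>a\<in>A. R a C p"
proof -
  have "\<forall>a\<in>A. \<exists>C. C \<ge> 0 \<and> (\<forall>\<^sub>F p in F. R a C p)" using ex by blast
  from bchoice[OF this] obtain c where c: "\<And>a. a \<in> A \<Longrightarrow> c a \<ge> 0"
      "\<And>a. a \<in> A \<Longrightarrow> \<forall>\<^sub>F p in F. R a (c a) p"
    by blast
  have "\<forall>\<^sub>F p in F. \<forall>a\<in>A. R a (sum c A) p"
  proof (intro eventually_ball_finite[OF assms(1)] ballI)
    fix a assume a: "a \<in> A"
    have "c a \<le> sum c A" using c(1) assms(1) a by (intro member_le_sum) auto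
    with c(2)[OF a] show "\<forall>\<^sub>F p in F. R a (sum c A) p" by (auto elim!: eventually_mono intro: mono)
  qed
  moreover have "0 \<le> sum c A" using c(1) by (rule sum_nonneg)
  ultimately show ?thesis by blast
qed

text \<open>A neighbourhood of 0 contains both signs of \<open>t\<close>. For a polyhedron these are
  therefore the directions parallel to the smallest face containing \<open>x\<close>, and they are
  closed under negation.\<close>

definition feasible_line :: "'a::real_vector set \<Rightarrow> 'a \<Rightarrow> 'a \<Rightarrow> bool" where
  "feasible_line S x \<theta> \<longleftrightarrow> (\<forall>\<^sub>F t in nhds (0::real). x + t *\<^sub>R \<theta> \<in> S)"

lemma polyhedron_inequalities:
  assumes "polyhedron S"
  obtains I where "finite I" "S = {x. \<forall>(a, b)\<in>I. a \<bullet> x \<le> b}"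
proof -
  obtain F where F: "finite F" "S = \<Inter>F" "\<forall>h\<in>F. \<exists>a b. a \<noteq> 0 \<and> h = {x. a \<bullet> x \<le> b}"
    using assms unfolding polyhedron_def by blast
  from F(3) obtain a b where ab: "\<And>h. h \<in> F \<Longrightarrow> h = {x. a h \<bullet> x \<le> b h}" by metis
  have "S = {x. \<forall>(a, b)\<in>(\<lambda>h. (a h, b h)) ` F. a \<bullet> x \<le> b}"
    unfolding F(2) using ab by blast
  then show thesis using F(1) that by blast
qed

lemma polyhedron_affine_vimage:
  fixes L :: "'a::euclidean_space \<Rightarrow> 'b::euclidean_space"
  assumes "linear L" "polyhedron S"
  shows "polyhedron {x. L x + k \<in> S}"
proof -
  obtain I where I: "finite I" "S = {x. \<forall>(a, b)\<in>I. a \<bullet> x \<le> b}"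
    by (rule polyhedron_inequalities[OF assms(2)])
  have "{x. L x + k \<in> S} = \<Inter>((\<lambda>(a, b). {x. adjoint L a \<bullet> x \<le> b - a \<bullet> k}) ` I)"
    by (auto simp: I(2) inner_add adjoint_clauses(2)[OF assms(1)] algebra_simps split: prod.splits)
  moreover have "polyhedron \<dots>"
    using I(1) by (intro polyhedron_Inter) (auto simp: polyhedron_halfspace_le)
  ultimately show ?thesis by simp
qed

text \<open>An inequality active at \<open>x\<close> near \<open>x\<^sub>0\<close> is active at
  \<open>x\<^sub>0\<close> as well, so \<open>x - x\<^sub>0\<close> lies in the common kernel of the
  normals active at \<open>x\<close>. The subspace estimate applies to this kernel. The kernel
  varies with \<open>x\<close>, but there are only finitely many active sets.\<close>

lemma quadratic_polyhedron_growth: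
  assumes q: "quadratic_expansion q G H" and S: "polyhedron S" and x\<^sub>0: "x\<^sub>0 \<in> S"
  shows "\<exists>C\<ge>0. \<forall>\<^sub>F x in nhds x\<^sub>0. \<forall>u. x \<in> S \<longrightarrow>
           (\<forall>\<theta>. feasible_line S x \<theta> \<longrightarrow> (G x - u) \<bullet> \<theta> = 0) \<longrightarrow> q x - q x\<^sub>0 \<le> C * (norm u)\<^sup>2"
proof -
  obtain I where I: "finite I" "S = {x. \<forall>(a, b)\<in>I. a \<bullet> x \<le> b}"
    by (rule polyhedron_inequalities[OF S])
  define L where "L J = {\<theta>. \<forall>r\<in>J. fst r \<bullet> \<theta> = 0}" for J :: "('a \<times> real) set"
  have L: "subspace (L J)" for J
    unfolding subspace_def L_def by (auto simp: inner_add)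
  define R where "R J C x \<longleftrightarrow> (\<forall>u. x - x\<^sub>0 \<in> L J \<longrightarrow> (\<forall>\<theta>\<in>L J. (G x - u) \<bullet> \<theta> = 0) \<longrightarrow>
           q x - q x\<^sub>0 \<le> C * (norm u)\<^sup>2)" for J C x
  have "\<exists>C\<ge>0. \<forall>\<^sub>F x in nhds x\<^sub>0. \<forall>J\<in>Pow I. R J C x"
  proof (rule eventually_uniform_constant)
    show "finite (Pow I)" using I(1) by simp
    show "\<exists>C\<ge>0. \<forall>\<^sub>F x in nhds x\<^sub>0. R J C x" for J
      unfolding R_def by (rule quadratic_subspace_growth[OF q L])
    show "R J C' x" if "R J C x" "C \<le> C'" for J C C' x
      unfolding R_def
    proof (intro allI impI)
      fix u assume "x - x\<^sub>0 \<in> L J" "\<forall>\<theta>\<in>L J. (G x - u) \<bullet> \<theta> = 0"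
      then have "q x - q x\<^sub>0 \<le> C * (norm u)\<^sup>2" using that(1) unfolding R_def by blast
      also have "\<dots> \<le> C' * (norm u)\<^sup>2" using that(2) by (intro mult_right_mono) auto
      finally show "q x - q x\<^sub>0 \<le> C' * (norm u)\<^sup>2" .
    qed
  qed
  then obtain C where C: "0 \<le> C" and ev1: "\<forall>\<^sub>F x in nhds x\<^sub>0. \<forall>J\<in>Pow I. R J C x"
    by blast
  have ev2: "\<forall>\<^sub>F x in nhds x\<^sub>0. \<forall>(a, b)\<in>I. a \<bullet> x\<^sub>0 < b \<longrightarrow> a \<bullet> x < b"
  proof (intro eventually_ball_finite[OF I(1)] ballI, clarify)
    fix a b show "\<forall>\<^sub>F x in nhds x\<^sub>0. a \<bullet> x\<^sub>0 < b \<longrightarrow> a \<bullet> x < b"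
    proof (cases "a \<bullet> x\<^sub>0 < b")
      case True
      have "((\<lambda>x. a \<bullet> x) \<longlongrightarrow> a \<bullet> x\<^sub>0) (nhds x\<^sub>0)" by (intro tendsto_intros filterlim_ident)
      from order_tendstoD(2)[OF this True] show ?thesis by eventually_elim simp
    qed simp
  qed
  from ev1 ev2 have "\<forall>\<^sub>F x in nhds x\<^sub>0. \<forall>u. x \<in> S \<longrightarrow>
           (\<forall>\<theta>. feasible_line S x \<theta> \<longrightarrow> (G x - u) \<bullet> \<theta> = 0) \<longrightarrow> q x - q x\<^sub>0 \<le> C * (norm u)\<^sup>2"
  proof (eventually_elim, intro allI impI)
    fix x u
    assume R: "\<forall>J\<in>Pow I. R J C x" and inact: "\<forall>(a, b)\<in>I. a \<bullet> x\<^sub>0 < b \<longrightarrow> a \<bullet> x < b"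
      and x: "x \<in> S" and u: "\<forall>\<theta>. feasible_line S x \<theta> \<longrightarrow> (G x - u) \<bullet> \<theta> = 0"
    define J where "J = {(a, b)\<in>I. a \<bullet> x = b}"
    have J: "J \<in> Pow I" by (auto simp: J_def)
    have "x - x\<^sub>0 \<in> L J"
    proof -
      have "a \<bullet> x = a \<bullet> x\<^sub>0" if "(a, b) \<in> J" for a b
      proof -
        have "(a, b) \<in> I" "a \<bullet> x = b" using that by (auto simp: J_def)
        moreover have "a \<bullet> x\<^sub>0 \<le> b" using x\<^sub>0 \<open>(a, b) \<in> I\<close> by (auto simp: I(2))
        ultimately show ?thesis using inact by force
      qed
      then show ?thesis by (force simp: L_def inner_diff)
    qed
    moreover have "\<forall>\<theta>\<in>L J. (G x - u) \<bullet> \<theta> = 0"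
    proof
      fix \<theta> assume \<theta>: "\<theta> \<in> L J"
      \<comment> \<open>A small move either way along \<open>\<theta>\<close> preserves the active
        equations and keeps the inactive inequalities strict.\<close>
      have "\<forall>\<^sub>F t in nhds (0::real). \<forall>(a, b)\<in>I. a \<bullet> (x + t *\<^sub>R \<theta>) \<le> b"
      proof (intro eventually_ball_finite[OF I(1)] ballI, clarify)
        fix a b assume ab: "(a, b) \<in> I"
        show "\<forall>\<^sub>F t in nhds (0::real). a \<bullet> (x + t *\<^sub>R \<theta>) \<le> b"
        proof (cases "a \<bullet> x = b")
          case True
          then have "(a, b) \<in> J" using ab by (auto simp: J_def)
          then have "a \<bullet> \<theta> = 0" using \<theta> by (force simp: L_def)
          then show ?thesis using True by (simp add: inner_add)
        next
          case False
          then have "a \<bullet> (x + 0 *\<^sub>R \<theta>) < b" using x ab by (force simp: I(2))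
          moreover have "((\<lambda>t. a \<bullet> (x + t *\<^sub>R \<theta>)) \<longlongrightarrow> a \<bullet> (x + 0 *\<^sub>R \<theta>)) (nhds 0)"
            by (intro tendsto_intros filterlim_ident)
          ultimately have "\<forall>\<^sub>F t in nhds (0::real). a \<bullet> (x + t *\<^sub>R \<theta>) < b"
            by (intro order_tendstoD(2))
          then show ?thesis by eventually_elim simp
        qed
      qed
      then have "feasible_line S x \<theta>" by (simp add: feasible_line_def I(2))
      then show "(G x - u) \<bullet> \<theta> = 0" using u by blast
    qed
    ultimately show "q x - q x\<^sub>0 \<le> C * (norm u)\<^sup>2" using R J unfolding R_def by blast
  qed
  then show ?thesis using C by blast
qed

section \<open>Quotients of quadratic functions\<close>

text \<open>Only a piece passing through \<open>x\<^sub>0\<close> with value \<open>c\<close>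
  matters. If \<open>x\<^sub>0\<close> is outside the closed set \<open>S\<close>, nearby points are
  outside too; if the quotient at \<open>x\<^sub>0\<close> exceeds \<open>c\<close>, continuity
  keeps it away from values near \<open>c\<close>. Both cases are vacuous and take the constant
  0.\<close>

lemma quadratic_quotient_growth:
  fixes x\<^sub>0 :: "'a::euclidean_space"
  assumes N: "quadratic_expansion N GN HN" and D: "quadratic_expansion D GD HD"
    and S: "polyhedron S"
    and x\<^sub>0: "x\<^sub>0 \<in> S \<longrightarrow> 0 < D x\<^sub>0 \<and> c \<le> N x\<^sub>0 / D x\<^sub>0"
  shows "\<exists>C\<ge>0. \<forall>\<^sub>F p in nhds x\<^sub>0 \<times>\<^sub>F nhds c. \<forall>u. fst p \<in> S \<longrightarrow> c < snd p \<longrightarrow> 0 < D (fst p) \<longrightarrow>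
           snd p = N (fst p) / D (fst p) \<longrightarrow>
           (\<forall>\<theta>. feasible_line S (fst p) \<theta> \<longrightarrow>
              (GN (fst p) - snd p *\<^sub>R GD (fst p) - D (fst p) *\<^sub>R u) \<bullet> \<theta> = 0) \<longrightarrow>
           snd p - c \<le> C * (norm u)\<^sup>2"
proof -
  let ?F = "nhds x\<^sub>0 \<times>\<^sub>F nhds c"
  have ev_fst: "\<forall>\<^sub>F p in ?F. Q (fst p)" if "\<forall>\<^sub>F x in nhds x\<^sub>0. Q x" for Q
    using that filterlim_fst by (rule eventually_compose_filterlim)
  have ev_snd: "\<forall>\<^sub>F p in ?F. Q (snd p)" if "\<forall>\<^sub>F d in nhds c. Q d" for Q
    using that filterlim_snd by (rule eventually_compose_filterlim)
  note limN = quadratic_expansion_continuous[OF N] and limD = quadratic_expansion_continuous[OF D]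
  consider "x\<^sub>0 \<notin> S" | "x\<^sub>0 \<in> S" "c < N x\<^sub>0 / D x\<^sub>0" | "x\<^sub>0 \<in> S" "c = N x\<^sub>0 / D x\<^sub>0"
    using x\<^sub>0 by fastforce
  then show ?thesis
  proof cases
    case 1
    have "\<forall>\<^sub>F x in nhds x\<^sub>0. x \<in> - S"
      using 1 polyhedron_imp_closed[OF S] by (intro eventually_nhds_in_open) auto
    from ev_fst[OF this] have "\<forall>\<^sub>F p in ?F. fst p \<notin> S" by simp
    then show ?thesis by (intro exI[of _ 0]) (auto elim: eventually_mono)
  next
    case 2
    obtain m where m: "c < m" "m < N x\<^sub>0 / D x\<^sub>0" using dense[OF 2(2)] by blast
    have "((\<lambda>x. N x / D x) \<longlongrightarrow> N x\<^sub>0 / D x\<^sub>0) (nhds x\<^sub>0)"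
      using x\<^sub>0 2(1) by (intro tendsto_intros limN limD) auto
    from ev_fst[OF order_tendstoD(1)[OF this m(2)]]
    have 3: "\<forall>\<^sub>F p in ?F. m < N (fst p) / D (fst p)" .
    have "\<forall>\<^sub>F d in nhds c. d < m" using m(1) by (intro order_tendstoD(2)[OF filterlim_ident])
    from 3 ev_snd[OF this] have "\<forall>\<^sub>F p in ?F. snd p \<noteq> N (fst p) / D (fst p)"
      by eventually_elim simp
    then show ?thesis by (intro exI[of _ 0]) (auto elim: eventually_mono)
  next
    case 3
    have D0: "0 < D x\<^sub>0" using x\<^sub>0 3 by simp
    let ?q = "\<lambda>x. N x - c * D x" and ?G = "\<lambda>x. GN x - c *\<^sub>R GD x"
    obtain C where C: "0 \<le> C" and ev: "\<forall>\<^sub>F x in nhds x\<^sub>0. \<forall>u. x \<in> S \<longrightarrow>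
           (\<forall>\<theta>. feasible_line S x \<theta> \<longrightarrow> (?G x - u) \<bullet> \<theta> = 0) \<longrightarrow> ?q x - ?q x\<^sub>0 \<le> C * (norm u)\<^sup>2"
      using quadratic_polyhedron_growth[OF quadratic_expansion_diff_scale[OF N D, of c] S 3(1)]
      by blast
    \<comment> \<open>Near \<open>x\<^sub>0\<close> these give \<open>m < D x\<close>,
      \<open>norm (GD x) < M\<close> and \<open>D x < K\<close>; each leaves strict room around the
      value at \<open>x\<^sub>0\<close>.\<close>
    define m M K where "m = D x\<^sub>0 / 2" and "M = norm (GD x\<^sub>0) + 1" and "K = 2 * D x\<^sub>0"
    have pos: "0 < m" "0 < M" "0 < K" using D0 by (auto simp: m_def M_def K_def add_nonneg_pos)
    have ev1: "\<forall>\<^sub>F x in nhds x\<^sub>0. m < D x" "\<forall>\<^sub>F x in nhds x\<^sub>0. D x < K"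
      by (rule order_tendstoD[OF limD(1)], use D0 in \<open>simp add: m_def K_def\<close>)+
    have ev2: "\<forall>\<^sub>F x in nhds x\<^sub>0. norm (GD x) < M"
      by (rule order_tendstoD(2)[OF tendsto_norm[OF limD(2)]]) (simp add: M_def)
    have "((\<lambda>d. (d - c) * (2 * C * M\<^sup>2)) \<longlongrightarrow> (c - c) * (2 * C * M\<^sup>2)) (nhds c)"
      by (intro tendsto_intros filterlim_ident)
    \<comment> \<open>This threshold is the absorption condition: in the bound on
      \<open>C * (norm v)\<^sup>2\<close> below, the term quadratic in \<open>d - c\<close> costs at
      most half of \<open>(d - c) * m\<close>.\<close>
    then have ev3: "\<forall>\<^sub>F d in nhds c. (d - c) * (2 * C * M\<^sup>2) < m / 2"
      by (rule order_tendstoD(2)) (use pos in simp)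
    \<comment> \<open>After absorption
      \<open>(d - c) * (m / 2) \<le> 2 * C * K\<^sup>2 * (norm u)\<^sup>2\<close> remains; solving
      for \<open>d - c\<close> gives this constant.\<close>
    define C' where "C' = 4 * C * K\<^sup>2 / m"
    have "0 \<le> C'" using C pos by (simp add: C'_def)
    moreover have "\<forall>\<^sub>F p in ?F. \<forall>u. fst p \<in> S \<longrightarrow> c < snd p \<longrightarrow> 0 < D (fst p) \<longrightarrow>
           snd p = N (fst p) / D (fst p) \<longrightarrow>
           (\<forall>\<theta>. feasible_line S (fst p) \<theta> \<longrightarrow>
              (GN (fst p) - snd p *\<^sub>R GD (fst p) - D (fst p) *\<^sub>R u) \<bullet> \<theta> = 0) \<longrightarrow>
           snd p - c \<le> C' * (norm u)\<^sup>2"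
      using ev_fst[OF ev] ev_fst[OF ev1(1)] ev_fst[OF ev1(2)] ev_fst[OF ev2] ev_snd[OF ev3]
    proof (eventually_elim, intro allI impI)
      fix p :: "'a \<times> real" and u
      define x d where "x = fst p" and "d = snd p"
      assume growth: "\<forall>u. fst p \<in> S \<longrightarrow>
           (\<forall>\<theta>. feasible_line S (fst p) \<theta> \<longrightarrow> (?G (fst p) - u) \<bullet> \<theta> = 0) \<longrightarrow>
           ?q (fst p) - ?q x\<^sub>0 \<le> C * (norm u)\<^sup>2"
        and "m < D (fst p)" "D (fst p) < K" "norm (GD (fst p)) < M"
          "(snd p - c) * (2 * C * M\<^sup>2) < m / 2"
        and "fst p \<in> S" "c < snd p" "0 < D (fst p)" "snd p = N (fst p) / D (fst p)"
        and stat: "\<forall>\<theta>. feasible_line S (fst p) \<theta> \<longrightarrow>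
              (GN (fst p) - snd p *\<^sub>R GD (fst p) - D (fst p) *\<^sub>R u) \<bullet> \<theta> = 0"
      note elim = this[folded x_def d_def]
      \<comment> \<open>The gradient of \<open>?q\<close> is that of \<open>N - d * D\<close> with
        \<open>d\<close> frozen, plus \<open>(d - c) *\<^sub>R GD x\<close>. Along feasible lines
        the former pairs like \<open>D x *\<^sub>R u\<close>, so \<open>v\<close> pairs like the
        whole gradient.\<close>
      define v where "v = (d - c) *\<^sub>R GD x + D x *\<^sub>R u"
      have d: "N x = d * D x" and dc: "0 \<le> d - c" using elim by auto
      have "?q x - ?q x\<^sub>0 \<le> C * (norm v)\<^sup>2"
      proof -
        have "(?G x - v) \<bullet> \<theta> = 0" if "feasible_line S x \<theta>" for \<theta>
          using elim(10) that by (auto simp: v_def algebra_simps inner_simps)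
        then show ?thesis using elim(1) elim(6) by blast
      qed
      moreover have "?q x - ?q x\<^sub>0 = (d - c) * D x"
        using 3 D0 d by (simp add: algebra_simps)
      ultimately have 1: "(d - c) * D x \<le> C * (norm v)\<^sup>2" by simp
      have "norm v \<le> (d - c) * M + K * norm u"
      proof -
        have "norm v \<le> norm ((d - c) *\<^sub>R GD x) + norm (D x *\<^sub>R u)"
          unfolding v_def by (rule norm_triangle_ineq)
        also have "\<dots> = (d - c) * norm (GD x) + D x * norm u" using dc elim by simp
        also have "\<dots> \<le> (d - c) * M + K * norm u"
          using dc elim by (intro add_mono mult_left_mono mult_right_mono) auto
        finally show ?thesis .
      qed
      then have "(norm v)\<^sup>2 \<le> ((d - c) * M + K * norm u)\<^sup>2" by (intro power_mono) auto
      also have "\<dots> \<le> 2 * ((d - c) * M)\<^sup>2 + 2 * (K * norm u)\<^sup>2"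
        using sum_squares_bound[of "(d - c) * M" "K * norm u"] by (simp add: power2_sum)
      finally have "C * (norm v)\<^sup>2 \<le> C * (2 * ((d - c) * M)\<^sup>2 + 2 * (K * norm u)\<^sup>2)"
        using C by (intro mult_left_mono)
      also have "\<dots> = (d - c) * ((d - c) * (2 * C * M\<^sup>2)) + 2 * C * K\<^sup>2 * (norm u)\<^sup>2"
        by (simp add: power2_eq_square algebra_simps)
      also have "\<dots> \<le> (d - c) * (m / 2) + 2 * C * K\<^sup>2 * (norm u)\<^sup>2"
        using dc elim by (intro add_right_mono mult_left_mono) auto
      finally have "(d - c) * D x \<le> (d - c) * (m / 2) + 2 * C * K\<^sup>2 * (norm u)\<^sup>2" using 1 by simp
      moreover have "(d - c) * m \<le> (d - c) * D x" using dc elim by (intro mult_left_mono) auto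
      ultimately have "(d - c) * m \<le> 4 * C * K\<^sup>2 * (norm u)\<^sup>2"
        by (simp add: left_diff_distrib diff_divide_distrib)
      then have "d - c \<le> C' * (norm u)\<^sup>2" using pos by (simp add: C'_def field_simps)
      then show "snd p - c \<le> C' * (norm u)\<^sup>2" by (simp add: x_def d_def)
    qed
    ultimately show ?thesis by blast
  qed
qed

section \<open>Frechet subgradients along feasible lines\<close>

lemma ereal_quotient_bound:
  fixes \<phi> :: ereal
  assumes "\<phi> \<le> ereal r" and "- ereal e < (\<phi> - ereal d - ereal a) / ereal n" and "0 < n"
  shows "- e * n < r - d - a"
proof (cases \<phi>)
  case (real s)
  then have "- e < (s - d - a) / n" using assms by simp
  then have "- e * n < s - d - a" using assms(3) by (simp add: field_simps)
  then show ?thesis using assms(1) real by simp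
\<comment> \<open>The upper bound by \<open>r\<close> excludes the value \<infinity>, and the lower
  bound on the quotient excludes -\<infinity>.\<close>
qed (use assms in auto)

text \<open>The quotient \<open>N / D\<close> majorizes \<open>\<phi>\<close> on the line and agrees
  with it at \<open>x\<close>, so its difference quotients for \<open>t > 0\<close> majorize those
  of \<open>\<phi>\<close>. Hence \<open>u \<bullet> \<theta>\<close> is at most the directional
  derivative of \<open>N / D\<close>; multiplying by \<open>D x\<close> clears the
  denominator.\<close>

lemma frechet_subgradient_touching_above:
  assumes N: "quadratic_expansion N GN HN" and D: "quadratic_expansion D GD HD"
    and above: "\<And>z. z \<in> S \<Longrightarrow> 0 < D z \<Longrightarrow> \<phi> z \<le> ereal (N z / D z)"
    and x: "0 < D x" "\<phi> x = ereal (N x / D x)"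
    and u: "u \<in> frechet_subdifferential \<phi> x" and \<theta>: "feasible_line S x \<theta>"
  shows "0 \<le> (GN x - (N x / D x) *\<^sub>R GD x - D x *\<^sub>R u) \<bullet> \<theta>"
proof (cases "\<theta> = 0")
  case False
  define r where "r t = N (x + t *\<^sub>R \<theta>) / D (x + t *\<^sub>R \<theta>)" for t
  define r' where "r' = ((GN x \<bullet> \<theta>) * D x - N x * (GD x \<bullet> \<theta>)) / (D x * D x)"
  have line: "q (x + t *\<^sub>R \<theta>) = q x + t * (G x \<bullet> \<theta>) + t * t * (\<theta> \<bullet> H \<theta>) / 2"
    if "quadratic_expansion q G H" for q G H t
    using quadratic_expansionD(3)[OF that, of x "t *\<^sub>R \<theta>"]
    by (simp add: linear_scale[OF quadratic_expansionD(1)[OF that]])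
  have "(r has_real_derivative r') (at 0)"
    unfolding r_def line[OF N] line[OF D] r'_def
    by (rule derivative_eq_intros refl | use x in simp)+
  then have lim: "((\<lambda>t. (r t - r 0) / t) \<longlongrightarrow> r') (at_right 0)"
    unfolding has_field_derivative_iff by (auto intro: filterlim_mono at_le)
  have tend: "((\<lambda>t. x + t *\<^sub>R \<theta>) \<longlongrightarrow> x + 0 *\<^sub>R \<theta>) (at_right 0)"
    by (intro tendsto_intros)
  then have to_x: "filterlim (\<lambda>t. x + t *\<^sub>R \<theta>) (at x) (at_right 0)"
    using False by (auto simp: filterlim_at eventually_at_filter)
  have "((\<lambda>t. D (x + t *\<^sub>R \<theta>)) \<longlongrightarrow> D x) (at_right 0)"
    using filterlim_compose[OF quadratic_expansion_continuous(1)[OF D], of "\<lambda>t. x + t *\<^sub>R \<theta>"] tend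
    by simp
  then have evD: "\<forall>\<^sub>F t in at_right 0. 0 < D (x + t *\<^sub>R \<theta>)" by (rule order_tendstoD) fact
  have evS: "\<forall>\<^sub>F t in at_right 0. x + t *\<^sub>R \<theta> \<in> S"
    using \<theta> at_within_le_nhds unfolding feasible_line_def by (rule filter_leD[rotated])
  have "u \<bullet> \<theta> \<le> r' + e" if "0 < e" for e
  proof -
    \<comment> \<open>The Frechet error is relative to \<open>norm (t *\<^sub>R \<theta>)\<close>;
      this scaling turns it into \<open>e * t\<close>.\<close>
    define e' where "e' = e / norm \<theta>"
    have e': "0 < e'" "e' * norm \<theta> = e" using False that by (auto simp: e'_def)
    have "\<forall>\<^sub>F z in at x. - ereal e' < (\<phi> z - \<phi> x - ereal (u \<bullet> (z - x))) / ereal (norm (z - x))"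
      using u e'(1) unfolding frechet_subdifferential_def le_Liminf_iff
      by (auto simp: zero_ereal_def)
    from eventually_compose_filterlim[OF this to_x] evD evS eventually_at_right_less[of 0]
    have "\<forall>\<^sub>F t in at_right 0. u \<bullet> \<theta> - e \<le> (r t - r 0) / t"
    proof eventually_elim
      case (elim t)
      have "- e' * norm (t *\<^sub>R \<theta>) < r t - r 0 - u \<bullet> (t *\<^sub>R \<theta>)"
      proof (rule ereal_quotient_bound)
        show "\<phi> (x + t *\<^sub>R \<theta>) \<le> ereal (r t)" using above elim by (simp add: r_def)
        show "- ereal e' < (\<phi> (x + t *\<^sub>R \<theta>) - ereal (r 0) - ereal (u \<bullet> t *\<^sub>R \<theta>)) / ereal (norm (t *\<^sub>R \<theta>))"
          using elim(1) x(2) by (simp add: r_def)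
        show "0 < norm (t *\<^sub>R \<theta>)" using elim False by simp
      qed
      then have "(u \<bullet> \<theta> - e) * t < r t - r 0"
        using elim e'(2) by (simp add: algebra_simps)
      then show ?case using elim by (simp add: field_simps)
    qed
    then have "u \<bullet> \<theta> - e \<le> r'" by (intro tendsto_lowerbound[OF lim]) auto
    then show ?thesis by simp
  qed
  then have "u \<bullet> \<theta> \<le> r'" by (rule field_le_epsilon)
  then have "D x * (u \<bullet> \<theta>) \<le> D x * r'" using x by (intro mult_left_mono) auto
  also have "D x * r' = GN x \<bullet> \<theta> - N x / D x * (GD x \<bullet> \<theta>)"
    using x by (simp add: r'_def field_simps)
  finally show ?thesis by (simp add: inner_diff)
qed simp

lemma frechet_subgradient_stationary:
  assumes "quadratic_expansion N GN HN" "quadratic_expansion D GD HD"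
    and "\<And>z. z \<in> S \<Longrightarrow> 0 < D z \<Longrightarrow> \<phi> z \<le> ereal (N z / D z)"
    and "0 < D x" "\<phi> x = ereal (N x / D x)"
    and "u \<in> frechet_subdifferential \<phi> x" and \<theta>: "feasible_line S x \<theta>"
  shows "(GN x - (N x / D x) *\<^sub>R GD x - D x *\<^sub>R u) \<bullet> \<theta> = 0"
proof (rule antisym)
  have "filterlim uminus (nhds (0::real)) (nhds 0)"
    using tendsto_minus[OF filterlim_ident, of "0::real"] by simp
  from eventually_compose_filterlim[OF \<theta>[unfolded feasible_line_def] this]
  have "feasible_line S x (- \<theta>)" by (simp add: feasible_line_def)
  from frechet_subgradient_touching_above[OF assms(1-6) this]
  show "(GN x - (N x / D x) *\<^sub>R GD x - D x *\<^sub>R u) \<bullet> \<theta> \<le> 0" by simp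
  show "0 \<le> (GN x - (N x / D x) *\<^sub>R GD x - D x *\<^sub>R u) \<bullet> \<theta>"
    by (rule frechet_subgradient_touching_above[OF assms])
qed

section \<open>The Kurdyka-Lojasiewicz property with exponent 1/2\<close>

text \<open>The estimate passes from Frechet to limiting subgradients because the approximating
  values converge along with the points: the strict bounds
  \<open>c < \<phi> z < c + \<epsilon>\<close> persist along the sequence. Its square root is then
  the KL inequality for a multiple of \<open>s powr (1/2)\<close>.\<close>

lemma KL_half_from_growth:
  fixes \<phi> :: "'a::euclidean_space \<Rightarrow> ereal"
  assumes c: "\<phi> x\<^sub>0 = ereal c" and "0 \<le> C"
    and ev: "\<forall>\<^sub>F p in nhds x\<^sub>0 \<times>\<^sub>F nhds c. \<forall>u\<in>frechet_subdifferential \<phi> (fst p).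
           \<phi> (fst p) = ereal (snd p) \<longrightarrow> c < snd p \<longrightarrow> snd p - c \<le> C * (norm u)\<^sup>2"
  shows "KL_property_at \<phi> (1/2) x\<^sub>0"
proof -
  obtain P\<^sub>1 P\<^sub>2 where P: "eventually P\<^sub>1 (nhds x\<^sub>0)" "eventually P\<^sub>2 (nhds c)"
    and bound: "\<And>x d u. P\<^sub>1 x \<Longrightarrow> P\<^sub>2 d \<Longrightarrow> u \<in> frechet_subdifferential \<phi> x \<Longrightarrow> \<phi> x = ereal d \<Longrightarrow>
      c < d \<Longrightarrow> d - c \<le> C * (norm u)\<^sup>2"
    using ev unfolding eventually_prod_filter by auto
  obtain \<delta> where \<delta>: "0 < \<delta>" "\<And>x. dist x x\<^sub>0 < \<delta> \<Longrightarrow> P\<^sub>1 x"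
    using P(1) unfolding eventually_nhds_metric by blast
  obtain \<epsilon> where \<epsilon>: "0 < \<epsilon>" "\<And>d. dist d c < \<epsilon> \<Longrightarrow> P\<^sub>2 d"
    using P(2) unfolding eventually_nhds_metric by blast
  \<comment> \<open>The added 1 keeps \<open>k\<close> positive when \<open>C = 0\<close>. The
    desingularizing function is \<open>2 * k * sqrt s\<close>, with derivative
    \<open>k / sqrt s\<close>.\<close>
  define k where "k = sqrt (C + 1)"
  have k: "0 < k" "C \<le> k\<^sup>2" using \<open>0 \<le> C\<close> by (auto simp: k_def)
  have lim_bound: "sqrt (d - c) \<le> k * norm v"
    if z: "norm (z - x\<^sub>0) < \<delta>" "\<phi> z = ereal d" "c < d" "d < c + \<epsilon>"
      and v: "v \<in> limiting_subdifferential \<phi> z" for z d v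
  proof -
    obtain xs ys where xs: "xs \<longlonglongrightarrow> z" "(\<lambda>k. \<phi> (xs k)) \<longlonglongrightarrow> \<phi> z"
      "\<And>k. ys k \<in> frechet_subdifferential \<phi> (xs k)" "ys \<longlonglongrightarrow> v"
      using v unfolding limiting_subdifferential_def by blast
    have "\<forall>\<^sub>F k in sequentially. dist (xs k) x\<^sub>0 < \<delta>"
      using z(1) by (intro order_tendstoD(2)[OF tendsto_dist[OF xs(1) tendsto_const]])
        (simp add: dist_norm)
    moreover have "\<forall>\<^sub>F k in sequentially. ereal c < \<phi> (xs k)" "\<forall>\<^sub>F k in sequentially. \<phi> (xs k) < ereal (c + \<epsilon>)"
      using z by (auto intro!: order_tendstoD[OF xs(2)])
    ultimately have "\<forall>\<^sub>F k in sequentially. real_of_ereal (\<phi> (xs k)) - c \<le> C * (norm (ys k))\<^sup>2"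
    proof eventually_elim
      case (elim k)
      then obtain e where e: "\<phi> (xs k) = ereal e" by (cases "\<phi> (xs k)") auto
      then have "c < e" "e < c + \<epsilon>" using elim by auto
      then have "e - c \<le> C * (norm (ys k))\<^sup>2"
        using elim e by (intro bound[OF \<delta>(2) \<epsilon>(2) xs(3)]) (auto simp: dist_norm)
      then show ?case by (simp add: e)
    qed
    moreover have "(\<lambda>k. real_of_ereal (\<phi> (xs k)) - c) \<longlonglongrightarrow> d - c"
      using xs(2) unfolding z(2) by (intro tendsto_intros lim_real_of_ereal)
    moreover have "(\<lambda>k. C * (norm (ys k))\<^sup>2) \<longlonglongrightarrow> C * (norm v)\<^sup>2"
      by (intro tendsto_intros xs(4))
    ultimately have "d - c \<le> C * (norm v)\<^sup>2" by (intro tendsto_le) auto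
    also have "\<dots> \<le> k\<^sup>2 * (norm v)\<^sup>2" using k by (intro mult_right_mono) auto
    finally have "d - c \<le> (k * norm v)\<^sup>2" by (simp add: power_mult_distrib)
    then show ?thesis using k by (intro real_le_lsqrt) auto
  qed
  have main: "1 \<le> ereal (deriv (\<lambda>s. 2 * k * s powr (1 - 1/2)) (real_of_ereal (\<phi> z - \<phi> x\<^sub>0)))
                * dist_zero (limiting_subdifferential \<phi> z)"
    if z: "norm (z - x\<^sub>0) < \<delta>" "\<phi> x\<^sub>0 < \<phi> z" "\<phi> z < \<phi> x\<^sub>0 + ereal \<epsilon>" for z
  proof -
    obtain d where d: "\<phi> z = ereal d" "c < d" "d < c + \<epsilon>"
      using z c by (cases "\<phi> z") auto
    define s where "s = d - c"
    have s: "0 < s" using d by (simp add: s_def)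
    have val: "real_of_ereal (\<phi> z - \<phi> x\<^sub>0) = s" by (simp add: d c s_def)
    have half: "1 - 1/2 = (1/2 :: real)" by simp
    have D: "((\<lambda>s. 2 * k * s powr (1/2)) has_real_derivative 2 * k * (1/2 * s powr (1/2 - 1))) (at s)"
      using s by (auto intro!: derivative_eq_intros)
    have "s powr (1/2 - 1) = sqrt s / s"
      unfolding powr_diff using s by (simp only: powr_half_sqrt powr_one)
    also have "\<dots> = 1 / sqrt s" using s by (simp add: real_divide_square_eq frac_eq_eq)
    finally have "2 * k * (1/2 * s powr (1/2 - 1)) = k / sqrt s" by (simp only:) simp
    with D have "((\<lambda>s. 2 * k * s powr (1/2)) has_real_derivative k / sqrt s) (at s)"
      by (rule DERIV_cong)
    then have deriv: "deriv (\<lambda>s. 2 * k * s powr (1 - 1/2)) s = k / sqrt s"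
      unfolding half by (rule DERIV_imp_deriv)
    \<comment> \<open>A lower bound for every member is enough, and it covers an empty
      subdifferential, whose distance is \<infinity>.\<close>
    have "ereal (sqrt s / k) \<le> dist_zero (limiting_subdifferential \<phi> z)"
      unfolding dist_zero_def
    proof (rule INF_greatest)
      fix v assume "v \<in> limiting_subdifferential \<phi> z"
      from lim_bound[OF z(1) d this] k show "ereal (sqrt s / k) \<le> ereal (norm v)"
        by (simp add: s_def field_simps)
    qed
    then have "ereal (k / sqrt s) * ereal (sqrt s / k)
        \<le> ereal (k / sqrt s) * dist_zero (limiting_subdifferential \<phi> z)"
      using k s by (intro ereal_mult_left_mono) auto
    moreover have "ereal (k / sqrt s) * ereal (sqrt s / k) = 1"
      using k s by (simp add: one_ereal_def)
    ultimately show ?thesis unfolding val deriv by (simp only:)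
  qed
  show ?thesis
    unfolding KL_property_at_def
  proof (intro exI conjI allI impI)
    show "0 < ereal \<epsilon>" "0 < \<delta>" "0 < 2 * k" using \<epsilon>(1) \<delta>(1) k(1) by simp_all
  qed (elim conjE, rule main)
qed

text \<open>Numerator pieces may overlap with different values and need only bound
  \<open>\<phi>\<close> from above, as pieces of a minimum do; denominator pieces agree with
  \<open>den\<close> exactly. The quotient estimate is applied to each pair on the intersection of
  its polyhedra, and \<open>attained\<close> provides a pair realizing \<open>\<phi>\<close> at
  every point of its domain.\<close>

theorem KL_half_piecewise_quadratic_quotient:
  fixes \<phi> :: "'a::euclidean_space \<Rightarrow> ereal" and den :: "'a \<Rightarrow> real"
    and \<N> \<D> :: "('a set \<times> ('a \<Rightarrow> real)) set"
  assumes "proper \<phi>" and fin: "finite \<N>" "finite \<D>"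
    and \<N>: "\<And>S p. (S, p) \<in> \<N> \<Longrightarrow> polyhedron S \<and> quadratic p"
    and \<D>: "\<And>S p. (S, p) \<in> \<D> \<Longrightarrow> polyhedron S \<and> quadratic p \<and> (\<forall>x\<in>S. den x = p x)"
    and above: "\<And>S p S' p' x. (S, p) \<in> \<N> \<Longrightarrow> x \<in> S \<Longrightarrow> (S', p') \<in> \<D> \<Longrightarrow> x \<in> S' \<Longrightarrow> 0 < den x \<Longrightarrow>
      \<phi> x \<le> ereal (p x / den x)"
    and attained: "\<And>x. \<phi> x < \<infinity> \<Longrightarrow> 0 < den x \<and> (\<exists>(S, p)\<in>\<N>. x \<in> S \<and> \<phi> x = ereal (p x / den x)) \<and>
      (\<exists>(S, p)\<in>\<D>. x \<in> S)"
  shows "KL_function \<phi> (1/2)"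
proof -
  have "KL_property_at \<phi> (1/2) x\<^sub>0" if fin0: "\<phi> x\<^sub>0 < \<infinity>" for x\<^sub>0
  proof -
    obtain c where c: "\<phi> x\<^sub>0 = ereal c" using attained[OF fin0] by auto
    \<comment> \<open>The guards restrict the estimate to points where the pair \<open>k\<close>
      realizes the value of \<open>\<phi>\<close>, since only there does the piece touch
      \<open>\<phi>\<close>.\<close>
    define R where "R k C p \<longleftrightarrow> (\<forall>u\<in>frechet_subdifferential \<phi> (fst p).
        fst p \<in> fst (fst k) \<inter> fst (snd k) \<longrightarrow> 0 < den (fst p) \<longrightarrow>
        snd p = snd (fst k) (fst p) / den (fst p) \<longrightarrow>
        \<phi> (fst p) = ereal (snd p) \<longrightarrow> c < snd p \<longrightarrow> snd p - c \<le> C * (norm u)\<^sup>2)"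
      for k :: "('a set \<times> ('a \<Rightarrow> real)) \<times> ('a set \<times> ('a \<Rightarrow> real))" and C :: real and p :: "'a \<times> real"
    have "\<exists>C\<ge>0. \<forall>\<^sub>F p in nhds x\<^sub>0 \<times>\<^sub>F nhds c. \<forall>k\<in>\<N> \<times> \<D>. R k C p"
    proof (rule eventually_uniform_constant)
      show "finite (\<N> \<times> \<D>)" using fin by simp
      show "R k C' p" if "R k C p" "C \<le> C'" for k C C' p
        unfolding R_def
      proof (intro ballI impI)
        fix u assume "u \<in> frechet_subdifferential \<phi> (fst p)"
          "fst p \<in> fst (fst k) \<inter> fst (snd k)" "0 < den (fst p)"
          "snd p = snd (fst k) (fst p) / den (fst p)" "\<phi> (fst p) = ereal (snd p)" "c < snd p"
        then have "snd p - c \<le> C * (norm u)\<^sup>2" using that(1) unfolding R_def by blast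
        also have "\<dots> \<le> C' * (norm u)\<^sup>2" using that(2) by (intro mult_right_mono) auto
        finally show "snd p - c \<le> C' * (norm u)\<^sup>2" .
      qed
      fix k assume "k \<in> \<N> \<times> \<D>"
      then obtain S p S' p' where k: "k = ((S, p), (S', p'))" "(S, p) \<in> \<N>" "(S', p') \<in> \<D>" by auto
      have S: "polyhedron (S \<inter> S')" using \<N>[OF k(2)] \<D>[OF k(3)] by auto
      have den: "den x = p' x" if "x \<in> S \<inter> S'" for x using \<D>[OF k(3)] that by auto
      obtain G H where N: "quadratic_expansion p G H"
        by (rule quadratic_expansion_exists[of p]) (use \<N>[OF k(2)] that in auto)
      obtain G' H' where D: "quadratic_expansion p' G' H'"
        by (rule quadratic_expansion_exists[of p']) (use \<D>[OF k(3)] that in auto)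
      have "x\<^sub>0 \<in> S \<inter> S' \<longrightarrow> 0 < p' x\<^sub>0 \<and> c \<le> p x\<^sub>0 / p' x\<^sub>0"
      proof
        assume x\<^sub>0: "x\<^sub>0 \<in> S \<inter> S'"
        have "0 < den x\<^sub>0" using attained[OF fin0] by blast
        then show "0 < p' x\<^sub>0 \<and> c \<le> p x\<^sub>0 / p' x\<^sub>0"
          using above[OF k(2) _ k(3), of x\<^sub>0] x\<^sub>0 by (simp add: c den)
      qed
      from quadratic_quotient_growth[OF N D S this]
      obtain C where C: "0 \<le> C" and ev: "\<forall>\<^sub>F z in nhds x\<^sub>0 \<times>\<^sub>F nhds c. \<forall>u.
           fst z \<in> S \<inter> S' \<longrightarrow> c < snd z \<longrightarrow> 0 < p' (fst z) \<longrightarrow> snd z = p (fst z) / p' (fst z) \<longrightarrow>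
           (\<forall>\<theta>. feasible_line (S \<inter> S') (fst z) \<theta> \<longrightarrow>
              (G (fst z) - snd z *\<^sub>R G' (fst z) - p' (fst z) *\<^sub>R u) \<bullet> \<theta> = 0) \<longrightarrow>
           snd z - c \<le> C * (norm u)\<^sup>2"
        by (elim exE conjE) (rule that)
      have "\<forall>\<^sub>F z in nhds x\<^sub>0 \<times>\<^sub>F nhds c. R k C z"
        using ev
      proof eventually_elim
        case (elim z)
        show ?case unfolding R_def k(1) fst_conv snd_conv
        proof (intro ballI impI)
          fix u assume u: "u \<in> frechet_subdifferential \<phi> (fst z)" and z: "fst z \<in> S \<inter> S'"
            and pos: "0 < den (fst z)" and d: "snd z = p (fst z) / den (fst z)"
            and val: "\<phi> (fst z) = ereal (snd z)" and "c < snd z"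
          have "(G (fst z) - (p (fst z) / p' (fst z)) *\<^sub>R G' (fst z) - p' (fst z) *\<^sub>R u) \<bullet> \<theta> = 0"
            if "feasible_line (S \<inter> S') (fst z) \<theta>" for \<theta>
          proof (rule frechet_subgradient_stationary[OF N D _ _ _ u that])
            show "\<phi> y \<le> ereal (p y / p' y)" if "y \<in> S \<inter> S'" "0 < p' y" for y
              using above[OF k(2) _ k(3), of y] that den[of y] by auto
          qed (use pos d val den[OF z] in auto)
          then show "snd z - c \<le> C * (norm u)\<^sup>2"
            using elim z pos d den[OF z] \<open>c < snd z\<close> by simp
        qed
      qed
      then show "\<exists>C\<ge>0. \<forall>\<^sub>F z in nhds x\<^sub>0 \<times>\<^sub>F nhds c. R k C z" using C by blast
    qed
    then obtain C where C: "0 \<le> C" and ev: "\<forall>\<^sub>F p in nhds x\<^sub>0 \<times>\<^sub>F nhds c. \<forall>k\<in>\<N> \<times> \<D>. R k C p"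
      by blast
    show ?thesis
    proof (rule KL_half_from_growth[where \<phi> = \<phi> and x\<^sub>0 = x\<^sub>0, OF c C])
      show "\<forall>\<^sub>F p in nhds x\<^sub>0 \<times>\<^sub>F nhds c. \<forall>u\<in>frechet_subdifferential \<phi> (fst p).
           \<phi> (fst p) = ereal (snd p) \<longrightarrow> c < snd p \<longrightarrow> snd p - c \<le> C * (norm u)\<^sup>2"
        using ev
      proof (eventually_elim, intro ballI impI)
        fix z u assume R: "\<forall>k\<in>\<N> \<times> \<D>. R k C z" and u: "u \<in> frechet_subdifferential \<phi> (fst z)"
          and val: "\<phi> (fst z) = ereal (snd z)" and "c < snd z"
        from attained[of "fst z"] val obtain S p S' p' where
          "0 < den (fst z)" "(S, p) \<in> \<N>" "fst z \<in> S" "ereal (snd z) = ereal (p (fst z) / den (fst z))"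
          "(S', p') \<in> \<D>" "fst z \<in> S'"
          by auto
        moreover from this R have "R ((S, p), (S', p')) C z" by blast
        ultimately show "snd z - c \<le> C * (norm u)\<^sup>2"
          using u val \<open>c < snd z\<close> unfolding R_def by simp
      qed
    qed
  qed
  then show ?thesis
    using assms(1) by (auto simp: KL_function_def dom_subdifferential_def effdom_def)
qed

section \<open>Polyhedral functions and their conjugates\<close>

text \<open>Each affine function is exact on its polyhedron and also a minorant everywhere. The
  global minorant is what a subgradient is, and it enters the computation of the conjugate.\<close>

definition affine_pieces :: "('a::euclidean_space \<Rightarrow> ereal) \<Rightarrow> ('a set \<times> 'a \<times> real) set \<Rightarrow> bool" where
  "affine_pieces \<psi> \<P> \<longleftrightarrow> finite \<P> \<and>
     (\<forall>S v \<beta>. (S, v, \<beta>) \<in> \<P> \<longrightarrow> polyhedron S \<and> (\<forall>x\<in>S. \<psi> x = ereal (v \<bullet> x + \<beta>)) \<and>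
        (\<forall>x. ereal (v \<bullet> x + \<beta>) \<le> \<psi> x)) \<and>
     (\<forall>x. \<psi> x < \<infinity> \<longrightarrow> (\<exists>S v \<beta>. (S, v, \<beta>) \<in> \<P> \<and> x \<in> S))"

lemma affine_piecesI:
  assumes "finite \<P>"
    and "\<And>S v \<beta>. (S, v, \<beta>) \<in> \<P> \<Longrightarrow>
       polyhedron S \<and> (\<forall>x\<in>S. \<psi> x = ereal (v \<bullet> x + \<beta>)) \<and> (\<forall>x. ereal (v \<bullet> x + \<beta>) \<le> \<psi> x)"
    and "\<And>x. \<psi> x < \<infinity> \<Longrightarrow> \<exists>S v \<beta>. (S, v, \<beta>) \<in> \<P> \<and> x \<in> S"
  shows "affine_pieces \<psi> \<P>"
  using assms unfolding affine_pieces_def by (intro conjI allI impI) auto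

lemma affine_piecesD:
  assumes "affine_pieces \<psi> \<P>"
  shows "finite \<P>"
    and "(S, v, \<beta>) \<in> \<P> \<Longrightarrow> polyhedron S"
    and "(S, v, \<beta>) \<in> \<P> \<Longrightarrow> x \<in> S \<Longrightarrow> \<psi> x = ereal (v \<bullet> x + \<beta>)"
    and "(S, v, \<beta>) \<in> \<P> \<Longrightarrow> ereal (v \<bullet> x + \<beta>) \<le> \<psi> x"
    and "\<psi> x < \<infinity> \<Longrightarrow> \<exists>S v \<beta>. (S, v, \<beta>) \<in> \<P> \<and> x \<in> S"
  using assms unfolding affine_pieces_def by simp_all

text \<open>Each lower facet of \<open>C\<close>, i.e. each inequality with a negative \<open>t\<close>-coefficient, yields one
  piece; at \<open>(y, \<psi> y)\<close> such an inequality must be active, since otherwise \<open>t\<close> could be decreased.\<close>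

lemma polyhedral_lower_envelope:
  fixes C :: "('a::euclidean_space \<times> real) set" and \<psi> :: "'a \<Rightarrow> ereal"
  assumes C: "polyhedron C"
    and lower: "\<And>y t. (y, t) \<in> C \<Longrightarrow> \<psi> y \<le> ereal t"
    and attained: "\<And>y. \<psi> y < \<infinity> \<Longrightarrow> \<exists>t. (y, t) \<in> C \<and> \<psi> y = ereal t"
  obtains \<P> where "affine_pieces \<psi> \<P>"
proof -
  obtain I where I: "finite I" "C = {x. \<forall>(a, b)\<in>I. a \<bullet> x \<le> b}"
    by (rule polyhedron_inequalities[OF C])
  \<comment> \<open>For \<open>\<alpha> < 0\<close> the inequality
    \<open>a \<bullet> y + \<alpha> * t \<le> b\<close> reads
    \<open>v \<bullet> y + \<beta> \<le> t\<close>. The piece lives where the point on this boundary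
    belongs to \<open>C\<close>.\<close>
  define piece where "piece r = (case r of ((a, \<alpha>), b) \<Rightarrow>
      let v = (- 1 / \<alpha>) *\<^sub>R a; \<beta> = b / \<alpha> in ({y. (y, v \<bullet> y + \<beta>) \<in> C}, v, \<beta>))"
    for r :: "('a \<times> real) \<times> real"
  define \<P> where "\<P> = piece ` {r \<in> I. snd (fst r) < 0}"
  have facet: "b / \<alpha> + (- 1 / \<alpha>) * (a \<bullet> y) \<le> t" if "((a, \<alpha>), b) \<in> I" "\<alpha> < 0" "(y, t) \<in> C" for a \<alpha> b y t
  proof -
    have "a \<bullet> y + \<alpha> * t \<le> b" using that(1,3) by (auto simp: I(2) inner_prod_def)
    then have "(b - a \<bullet> y) / \<alpha> \<le> t" using that(2) by (simp add: field_simps)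
    then show ?thesis by (simp add: diff_divide_distrib)
  qed
  show thesis
  proof (rule that[of \<P>], rule affine_piecesI)
    show "finite \<P>" using I(1) by (simp add: \<P>_def)
    show "polyhedron S \<and> (\<forall>x\<in>S. \<psi> x = ereal (v \<bullet> x + \<beta>)) \<and> (\<forall>x. ereal (v \<bullet> x + \<beta>) \<le> \<psi> x)"
      if mem: "(S, v, \<beta>) \<in> \<P>" for S v \<beta>
    proof -
      from mem obtain a \<alpha> b where r: "((a, \<alpha>), b) \<in> I" "\<alpha> < 0"
        and eqs: "v = (- 1 / \<alpha>) *\<^sub>R a" "\<beta> = b / \<alpha>" "S = {y. (y, v \<bullet> y + \<beta>) \<in> C}"
        by (auto simp: \<P>_def piece_def Let_def)
      have minorant: "ereal (v \<bullet> x + \<beta>) \<le> \<psi> x" for x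
      proof (cases "\<psi> x < \<infinity>")
        case True
        then obtain t where "(x, t) \<in> C" "\<psi> x = ereal t" using attained by blast
        then show ?thesis using facet[OF r, of x t] by (simp add: eqs)
      qed simp
      have "linear (\<lambda>y. (y, v \<bullet> y))"
        by (intro linearI) (auto simp: inner_add)
      from polyhedron_affine_vimage[OF this C, of "(0, \<beta>)"]
      have "polyhedron S" by (simp add: eqs(3))
      moreover have "\<psi> x = ereal (v \<bullet> x + \<beta>)" if "x \<in> S" for x
        using lower[of x "v \<bullet> x + \<beta>"] that minorant[of x] by (auto simp: eqs(3) intro: antisym)
      ultimately show ?thesis using minorant by blast
    qed
    show "\<exists>S v \<beta>. (S, v, \<beta>) \<in> \<P> \<and> y \<in> S" if fin: "\<psi> y < \<infinity>" for y
    proof -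
      obtain t where t: "(y, t) \<in> C" "\<psi> y = ereal t" using attained[OF fin] by blast
      have "\<exists>r\<in>I. snd (fst r) < 0 \<and> fst r \<bullet> (y, t) = snd r"
      proof (rule ccontr)
        assume none: "\<not> ?thesis"
        have "\<forall>\<^sub>F s in at_right (0::real). \<forall>r\<in>I. fst r \<bullet> (y, t - s) \<le> snd r"
        proof (intro eventually_ball_finite[OF I(1)] ballI)
          fix r assume r: "r \<in> I"
          obtain a \<alpha> b where r_eq: "r = ((a, \<alpha>), b)" by (metis prod.exhaust)
          have le: "a \<bullet> y + \<alpha> * t \<le> b" using t(1) r by (auto simp: r_eq I(2) inner_prod_def)
          show "\<forall>\<^sub>F s in at_right (0::real). fst r \<bullet> (y, t - s) \<le> snd r"
          proof (cases "\<alpha> < 0")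
            case True
            then have "a \<bullet> y + \<alpha> * (t - 0) < b" using none r le by (force simp: r_eq inner_prod_def)
            moreover have "((\<lambda>s. a \<bullet> y + \<alpha> * (t - s)) \<longlongrightarrow> a \<bullet> y + \<alpha> * (t - 0)) (at_right 0)"
              by (intro tendsto_intros)
            ultimately have "\<forall>\<^sub>F s in at_right 0. a \<bullet> y + \<alpha> * (t - s) < b" by (intro order_tendstoD(2))
            then show ?thesis by eventually_elim (simp add: r_eq inner_prod_def)
          next
            case False
            have "\<forall>\<^sub>F s in at_right (0::real). 0 < s" by (rule eventually_at_right_less)
            then show ?thesis
            proof eventually_elim
              case (elim s)
              have "0 \<le> \<alpha> * s" using elim False by simp
              then show ?case using le by (simp add: r_eq inner_prod_def right_diff_distrib)
            qed
          qed
        qed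
        from eventually_happens[OF eventually_conj[OF this eventually_at_right_less]]
        obtain s where "0 < s" "\<forall>r\<in>I. fst r \<bullet> (y, t - s) \<le> snd r"
          by (auto simp: trivial_limit_at_right_real)
        then have "(y, t - s) \<in> C" by (auto simp: I(2))
        from lower[OF this] show False using t(2) \<open>0 < s\<close> by simp
      qed
      then obtain a \<alpha> b where r: "((a, \<alpha>), b) \<in> I" "\<alpha> < 0" "a \<bullet> y + \<alpha> * t = b"
        by (auto simp: inner_prod_def)
      then have "t = b / \<alpha> + (- 1 / \<alpha>) * (a \<bullet> y)" by (simp add: field_simps)
      then have "y \<in> fst (piece ((a, \<alpha>), b))" using t(1) by (simp add: piece_def Let_def add.commute)
      moreover have "piece ((a, \<alpha>), b) \<in> \<P>" using r by (force simp: \<P>_def)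
      ultimately show ?thesis by (metis prod.collapse)
    qed
  qed
qed

lemma polyhedral_function_pieces:
  fixes \<psi> :: "'a::euclidean_space \<Rightarrow> ereal"
  assumes "polyhedral_function \<psi>" "\<And>x. \<psi> x \<noteq> - \<infinity>"
  obtains \<P> where "affine_pieces \<psi> \<P>"
proof (rule polyhedral_lower_envelope[of "epi \<psi>" \<psi>])
  show "polyhedron (epi \<psi>)" using assms(1) by (simp add: polyhedral_function_def)
  show "\<psi> y \<le> ereal t" if "(y, t) \<in> epi \<psi>" for y t using that by (simp add: epi_def)
  show "\<exists>t. (y, t) \<in> epi \<psi> \<and> \<psi> y = ereal t" if "\<psi> y < \<infinity>" for y
    using that assms(2)[of y] by (cases "\<psi> y") (auto simp: epi_def)
qed (rule that)

section \<open>Conjugate functions\<close>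

lemma conjugate_le_iff: "conjugate g y \<le> c \<longleftrightarrow> (\<forall>x. ereal (x \<bullet> y) - g x \<le> c)"
  by (simp add: conjugate_def SUP_le_iff)

lemma conjugate_ge: "ereal (x \<bullet> y) - g x \<le> conjugate g y"
  unfolding conjugate_def by (rule SUP_upper) simp

text \<open>Equality in the Fenchel-Young inequality at a subgradient. It is used to find points
  where \<open>eta\<close> is positive.\<close>

lemma eta_at_subgradient:
  assumes g: "\<And>x. g x = ereal (\<gamma> x)" and sub: "\<And>z. \<gamma> x + y \<bullet> (z - x) \<le> \<gamma> z"
  shows "conjugate g y < \<infinity>" and "eta g x y = g x"
proof -
  have "conjugate g y = ereal (x \<bullet> y - \<gamma> x)"
  proof (rule antisym)
    show "conjugate g y \<le> ereal (x \<bullet> y - \<gamma> x)"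
      unfolding conjugate_le_iff using sub by (auto simp: g inner_diff inner_commute algebra_simps)
    show "ereal (x \<bullet> y - \<gamma> x) \<le> conjugate g y" using conjugate_ge[of x y g] by (simp add: g)
  qed
  then show "conjugate g y < \<infinity>" "eta g x y = g x" by (simp_all add: eta_def g)
qed

text \<open>The graph of the conjugate of a maximum of affine functions is the lower boundary of the
  convex hull of the points (slope, negated intercept).\<close>

lemma conjugate_max_affine_hull:
  fixes g :: "'a::euclidean_space \<Rightarrow> ereal" and A :: "('a \<times> real) set"
  assumes A: "finite A"
    and minorant: "\<And>v t x. (v, t) \<in> A \<Longrightarrow> ereal (v \<bullet> x - t) \<le> g x"
    and active: "\<And>x. \<exists>(v, t)\<in>A. g x = ereal (v \<bullet> x - t)"
  shows "(y, t) \<in> convex hull A \<Longrightarrow> conjugate g y \<le> ereal t"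
    and "conjugate g y < \<infinity> \<Longrightarrow> \<exists>t. (y, t) \<in> convex hull A \<and> conjugate g y = ereal t"
proof -
  have real: "\<exists>r. g x = ereal r" for x using active[of x] by auto
  have upper: "conjugate g y \<le> ereal t" if "(y, t) \<in> convex hull A" for y t
    unfolding conjugate_le_iff
  proof
    fix x
    obtain r where r: "g x = ereal r" using real by blast
    have "A \<subseteq> {z. (x, - 1) \<bullet> z \<le> r}"
      using minorant[of _ _ x] by (auto simp: r inner_commute)
    then have "convex hull A \<subseteq> {z. (x, - 1) \<bullet> z \<le> r}" by (intro hull_minimal convex_halfspace_le)
    then show "ereal (x \<bullet> y) - g x \<le> ereal t" using that by (auto simp: r)
  qed
  then show "(y, t) \<in> convex hull A \<Longrightarrow> conjugate g y \<le> ereal t" .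
  assume fin: "conjugate g y < \<infinity>"
  have "conjugate g y \<noteq> - \<infinity>" using conjugate_ge[of 0 y g] real[of 0] by auto
  then obtain \<gamma> where \<gamma>: "conjugate g y = ereal \<gamma>" using fin by (cases "conjugate g y") auto
  \<comment> \<open>The hull plus an upward vertical ray: closed as the sum of a compact and a
    closed set, so a point outside it can be strictly separated.\<close>
  define K where "K = (\<Union>p\<in>convex hull A. \<Union>z\<in>{0} \<times> {0..}. {p + z})"
  have "(y, \<gamma>) \<in> K"
  proof (rule ccontr)
    assume "(y, \<gamma>) \<notin> K"
    have "convex K" unfolding K_def by (intro convex_sums convex_Times) auto
    have "closed K" unfolding K_def
      by (intro compact_closed_sums compact_convex_hull finite_imp_compact A closed_Times) auto
    from separating_hyperplane_closed_point[OF \<open>convex K\<close> this \<open>(y, \<gamma>) \<notin> K\<close>]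
    obtain n b where n: "n \<bullet> (y, \<gamma>) < b" "\<And>z. z \<in> K \<Longrightarrow> b < n \<bullet> z"
      by (elim exE conjE) (erule that, erule bspec)
    obtain a \<alpha> where n_eq: "n = (a, \<alpha>)" by (cases n)
    have ray: "b < a \<bullet> v + \<alpha> * (t + s)" if "(v, t) \<in> A" "0 \<le> s" for v t s
    proof -
      have "(v, t) + (0, s) \<in> K" 
        unfolding K_def using that(2)
        by (intro UN_I[of "(v, t)"] UN_I[of "(0, s)"] hull_inc that(1)) auto
      from n(2)[OF this] show ?thesis by (simp add: n_eq inner_prod_def)
    qed
    obtain v\<^sub>0 t\<^sub>0 where v\<^sub>0: "(v\<^sub>0, t\<^sub>0) \<in> A" using active[of 0] by blast
    have "0 \<le> \<alpha>"
    proof (rule ccontr)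
      assume \<alpha>: "\<not> 0 \<le> \<alpha>"
      define s where "s = (a \<bullet> v\<^sub>0 + \<alpha> * t\<^sub>0 - b) / (- \<alpha>)"
      have "0 \<le> s" using ray[OF v\<^sub>0, of 0] \<alpha> by (simp add: s_def divide_nonneg_neg)
      moreover have "\<alpha> * s = b - (a \<bullet> v\<^sub>0 + \<alpha> * t\<^sub>0)" using \<alpha> by (simp add: s_def)
      ultimately show False using ray[OF v\<^sub>0, of s] by (simp add: distrib_left)
    qed
    \<comment> \<open>The separating hyperplane may be vertical, that is
      \<open>\<alpha> = 0\<close>. Strict separation from the finite set \<open>A\<close> allows
      tilting it to a positive last coordinate.\<close>
    have "\<forall>\<^sub>F e in at_right (0::real). \<forall>p\<in>A. a \<bullet> y + (\<alpha> + e) * \<gamma> < a \<bullet> fst p + (\<alpha> + e) * snd p"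
    proof (intro eventually_ball_finite[OF A] ballI)
      fix p assume p: "p \<in> A"
      have "((\<lambda>e. a \<bullet> fst p + (\<alpha> + e) * snd p - (a \<bullet> y + (\<alpha> + e) * \<gamma>))
          \<longlongrightarrow> a \<bullet> fst p + (\<alpha> + 0) * snd p - (a \<bullet> y + (\<alpha> + 0) * \<gamma>)) (at_right 0)"
        by (intro tendsto_intros)
      moreover have "0 < a \<bullet> fst p + (\<alpha> + 0) * snd p - (a \<bullet> y + (\<alpha> + 0) * \<gamma>)"
        using ray[of "fst p" "snd p" 0] p n(1) by (simp add: n_eq inner_prod_def)
      ultimately have "\<forall>\<^sub>F e in at_right 0. 0 < a \<bullet> fst p + (\<alpha> + e) * snd p - (a \<bullet> y + (\<alpha> + e) * \<gamma>)"
        by (rule order_tendstoD(1))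
      then show "\<forall>\<^sub>F e in at_right 0. a \<bullet> y + (\<alpha> + e) * \<gamma> < a \<bullet> fst p + (\<alpha> + e) * snd p"
        by eventually_elim simp
    qed
    from eventually_happens[OF eventually_conj[OF this eventually_at_right_less]]
    obtain e where e: "0 < e" "\<And>p. p \<in> A \<Longrightarrow> a \<bullet> y + (\<alpha> + e) * \<gamma> < a \<bullet> fst p + (\<alpha> + e) * snd p"
      by (auto simp: trivial_limit_at_right_real)
    define k where "k = \<alpha> + e"
    have k: "0 < k" using \<open>0 \<le> \<alpha>\<close> e(1) by (simp add: k_def)
    \<comment> \<open>The slope of the tilted hyperplane. For the affine function active at this
      \<open>x\<close>, separation makes \<open>x \<bullet> y - g x\<close> exceed
      \<open>\<gamma>\<close>, the supremum of such values.\<close>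
    define x where "x = (- 1 / k) *\<^sub>R a"
    obtain v t where vt: "(v, t) \<in> A" "g x = ereal (v \<bullet> x - t)" using active[of x] by auto
    have "a \<bullet> y + k * \<gamma> < a \<bullet> v + k * t" using e(2)[OF vt(1)] by (simp add: k_def)
    then have "\<gamma> < x \<bullet> y - (v \<bullet> x - t)"
      using k by (simp add: x_def inner_commute field_simps)
    moreover have "x \<bullet> y - (v \<bullet> x - t) \<le> \<gamma>" using conjugate_ge[of x y g] by (simp add: \<gamma> vt(2))
    ultimately show False by simp
  qed
  then obtain t where "(y, t) \<in> convex hull A" "t \<le> \<gamma>" unfolding K_def by auto
  moreover from upper[OF this(1)] have "\<gamma> \<le> t" by (simp add: \<gamma>)
  ultimately show "\<exists>t. (y, t) \<in> convex hull A \<and> conjugate g y = ereal t" using \<gamma> by auto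
qed

section \<open>The pieces of the numerator and the denominator\<close>

definition quadratic_pieces :: "('a::euclidean_space set \<times> ('a \<Rightarrow> real)) set \<Rightarrow> bool" where
  "quadratic_pieces \<Q> \<longleftrightarrow> finite \<Q> \<and> (\<forall>(S, p)\<in>\<Q>. polyhedron S \<and> quadratic p)"

lemma quadratic_piecesD:
  assumes "quadratic_pieces \<Q>"
  shows "finite \<Q>" "(S, p) \<in> \<Q> \<Longrightarrow> polyhedron S" "(S, p) \<in> \<Q> \<Longrightarrow> quadratic p"
  using assms unfolding quadratic_pieces_def by auto

lemma quadratic_pieces_compose_linear:
  fixes L :: "'a::euclidean_space \<Rightarrow> 'b::euclidean_space"
  assumes "quadratic_pieces \<Q>" and L: "linear L"
  shows "quadratic_pieces ((\<lambda>(S, p). ({x. L x \<in> S}, \<lambda>x. p (L x))) ` \<Q>)"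
proof -
  have "polyhedron {x. L x \<in> S}" if "(S, p) \<in> \<Q>" for S p
    using polyhedron_affine_vimage[OF L quadratic_piecesD(2)[OF assms(1) that], of 0] by simp
  moreover have "quadratic (\<lambda>x. p (L x))" if "(S, p) \<in> \<Q>" for S p
    by (rule quadratic_compose_linear[OF quadratic_piecesD(3)[OF assms(1) that] L])
  ultimately show ?thesis
    using quadratic_piecesD(1)[OF assms(1)] by (auto simp: quadratic_pieces_def)
qed

lemma quadratic_quadratic_form: "quadratic (quadratic_form P q s)"
proof -
  have "quadratic (\<lambda>x. 1/2 * (x \<bullet> (P *v x)) + (q \<bullet> x + s))"
    by (intro quadratic_add quadratic_scale quadratic_inner_linear quadratic_affine
        matrix_vector_mul_linear)
  then show ?thesis by (simp add: quadratic_form_def[abs_def] add.assoc)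
qed

text \<open>Common form of both objectives: \<open>\<rho>\<close> is \<open>g\<close> for
  \<open>F\<close>, and \<open>eta\<close> on the product space for \<open>Q\<close>. Finiteness of
  \<open>\<rho>\<close> encodes membership in the domain of the conjugate, and
  \<open>x\<^sub>1\<close> witnesses properness.\<close>

lemma KL_half_quotient:
  fixes \<phi> \<zeta> \<rho> :: "'a::euclidean_space \<Rightarrow> ereal"
  assumes \<phi>: "\<And>x. \<phi> x = (if \<zeta> x < \<infinity> \<and> \<bar>\<rho> x\<bar> \<noteq> \<infinity> \<and> 0 < \<rho> x then \<zeta> x / \<rho> x else \<infinity>)"
    and dom: "\<zeta> x\<^sub>1 < \<infinity>" "\<bar>\<rho> x\<^sub>1\<bar> \<noteq> \<infinity>" "0 < \<rho> x\<^sub>1"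
    and \<N>: "quadratic_pieces \<N>" "\<And>S p x. (S, p) \<in> \<N> \<Longrightarrow> x \<in> S \<Longrightarrow> \<zeta> x \<le> ereal (p x)"
      "\<And>x. \<zeta> x < \<infinity> \<Longrightarrow> \<exists>(S, p)\<in>\<N>. x \<in> S \<and> \<zeta> x = ereal (p x)"
    and \<D>: "quadratic_pieces \<D>" "\<And>S p x. (S, p) \<in> \<D> \<Longrightarrow> x \<in> S \<Longrightarrow> \<rho> x = ereal (p x)"
      "\<And>x. \<bar>\<rho> x\<bar> \<noteq> \<infinity> \<Longrightarrow> \<exists>(S, p)\<in>\<D>. x \<in> S"
  shows "KL_function \<phi> (1/2)"
proof (rule KL_half_piecewise_quadratic_quotient[where \<N> = \<N> and \<D> = \<D>
      and den = "\<lambda>x. real_of_ereal (\<rho> x)"])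
  have val: "\<exists>S p. (S, p) \<in> \<N> \<and> x \<in> S \<and> \<zeta> x = ereal (p x) \<and> \<rho> x = ereal r \<and> 0 < r \<and> \<phi> x = ereal (p x / r)"
    if fin: "\<zeta> x < \<infinity>" "\<rho> x = ereal r" "0 < \<rho> x" for x r
  proof -
    obtain S p where "(S, p) \<in> \<N>" "x \<in> S" "\<zeta> x = ereal (p x)" using \<N>(3)[OF fin(1)] by blast
    then show ?thesis using fin by (intro exI[of _ S] exI[of _ p]) (simp add: \<phi>)
  qed
  have dom': "\<exists>r. \<zeta> x < \<infinity> \<and> \<rho> x = ereal r \<and> 0 < \<rho> x" if "\<phi> x < \<infinity>" for x
    using that unfolding \<phi>[of x] by (cases "\<rho> x") (auto split: if_splits)
  show "proper \<phi>"
    unfolding proper_on_def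
  proof (intro conjI ballI)
    show "\<phi> x \<noteq> - \<infinity>" for x
    proof (cases "\<phi> x < \<infinity>")
      case True
      then obtain r where "\<zeta> x < \<infinity>" "\<rho> x = ereal r" "0 < \<rho> x" using dom' by blast
      from val[OF this] show ?thesis by auto
    qed auto
    obtain r where "\<rho> x\<^sub>1 = ereal r" using dom(2) by (cases "\<rho> x\<^sub>1") auto
    from val[OF dom(1) this dom(3)] have "\<phi> x\<^sub>1 < \<infinity>" by auto
    then show "\<exists>x\<in>UNIV. \<phi> x < \<infinity>" by blast
  qed
  show "finite \<N>" "finite \<D>" using \<N>(1) \<D>(1) by (auto dest: quadratic_piecesD)
  show "polyhedron S \<and> quadratic p" if "(S, p) \<in> \<N>" for S p
    using quadratic_piecesD[OF \<N>(1)] that by blast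
  show "polyhedron S \<and> quadratic p \<and> (\<forall>x\<in>S. real_of_ereal (\<rho> x) = p x)" if "(S, p) \<in> \<D>" for S p
    using quadratic_piecesD[OF \<D>(1)] \<D>(2)[OF that] that by auto
  show "\<phi> x \<le> ereal (p x / real_of_ereal (\<rho> x))"
    if "(S, p) \<in> \<N>" "x \<in> S" "(S', p') \<in> \<D>" "x \<in> S'" "0 < real_of_ereal (\<rho> x)" for S p S' p' x
  proof -
    have \<rho>: "\<rho> x = ereal (p' x)" by (rule \<D>(2)[OF that(3,4)])
    have \<zeta>: "\<zeta> x \<le> ereal (p x)" by (rule \<N>(2)[OF that(1,2)])
    then have "\<zeta> x < \<infinity>" by auto
    from val[OF this \<rho>] that(5) obtain r where r: "\<zeta> x = ereal r" "\<phi> x = ereal (r / p' x)"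
      by (auto simp: \<rho>)
    then show ?thesis using \<zeta> that(5) by (simp add: \<rho> divide_right_mono)
  qed
  show "0 < real_of_ereal (\<rho> x) \<and>
      (\<exists>(S, p)\<in>\<N>. x \<in> S \<and> \<phi> x = ereal (p x / real_of_ereal (\<rho> x))) \<and> (\<exists>(S, p)\<in>\<D>. x \<in> S)"
    if fin: "\<phi> x < \<infinity>" for x
  proof -
    obtain r where r: "\<zeta> x < \<infinity>" "\<rho> x = ereal r" "0 < \<rho> x" using dom'[OF fin] by blast
    have "\<exists>(S, p)\<in>\<D>. x \<in> S" using \<D>(3)[of x] r(2) by simp
    then show ?thesis using val[OF r] r by auto
  qed
qed

text \<open>On a piece of \<open>\<Psi> i\<close> the \<open>i\<close>-th term plus \<open>h\<close>
  is quadratic. It bounds \<open>zeta f h\<close> from above because \<open>f\<close> is a minimum,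
  and equals it where index \<open>i\<close> attains that minimum.\<close>

lemma zeta_quadratic_pieces:
  fixes f h :: "real ^ 'n \<Rightarrow> ereal" and T :: nat
  assumes \<Psi>: "\<And>i. i \<in> {1..T} \<Longrightarrow> proper (\<Psi> i) \<and> polyhedral_function (\<Psi> i)" and "1 \<le> T"
    and f: "\<And>x. f x = Min ((\<lambda>i. \<Psi> i x + ereal (quadratic_form (P i) (q i) (s i) x)) ` {1..T})"
    and h: "quadratic_function h"
  obtains \<N> where "quadratic_pieces \<N>" "\<And>S p x. (S, p) \<in> \<N> \<Longrightarrow> x \<in> S \<Longrightarrow> zeta f h x \<le> ereal (p x)"
    "\<And>x. zeta f h x < \<infinity> \<Longrightarrow> \<exists>(S, p)\<in>\<N>. x \<in> S \<and> zeta f h x = ereal (p x)"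
proof -
  obtain k where k: "quadratic k" "\<And>x. h x = ereal (k x)"
    using h quadratic_quadratic_form unfolding quadratic_function_def by blast
  have "\<forall>i\<in>{1..T}. \<exists>\<P>. affine_pieces (\<Psi> i) \<P>"
  proof
    fix i assume "i \<in> {1..T}"
    from \<Psi>[OF this] have "polyhedral_function (\<Psi> i)" "\<And>x. \<Psi> i x \<noteq> - \<infinity>"
      by (auto simp: proper_on_def)
    then show "\<exists>\<P>. affine_pieces (\<Psi> i) \<P>"
      by (rule polyhedral_function_pieces) (rule exI)
  qed
  from bchoice[OF this] obtain \<P> where "\<And>i. i \<in> {1..T} \<Longrightarrow> affine_pieces (\<Psi> i) (\<P> i)"
    by blast
  note \<P> = affine_piecesD[OF this]
  define R where "R i = quadratic_form (P i) (q i) (s i)" for i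
  define \<N> where "\<N> = (\<Union>i\<in>{1..T}. (\<lambda>(S, v, \<beta>). (S, \<lambda>x. v \<bullet> x + \<beta> + R i x + k x)) ` \<P> i)"
  show thesis
  proof (rule that[of \<N>])
    show "quadratic_pieces \<N>"
      unfolding quadratic_pieces_def
    proof
      show "finite \<N>"
        unfolding \<N>_def by (intro finite_UN_I finite_imageI \<P>(1)) auto
      have "polyhedron S \<and> quadratic p" if "(S, p) \<in> \<N>" for S p
      proof -
        from that obtain i v \<beta> where "i \<in> {1..T}" "(S, v, \<beta>) \<in> \<P> i"
          "p = (\<lambda>x. v \<bullet> x + \<beta> + R i x + k x)"
          unfolding \<N>_def by auto
        moreover have "quadratic (\<lambda>x. v \<bullet> x + \<beta> + R i x + k x)"
          unfolding R_def
          by (rule quadratic_add[OF quadratic_add[OF quadratic_affine quadratic_quadratic_form] k(1)])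
        ultimately show ?thesis using \<P>(2) by blast
      qed
      then show "\<forall>(S, p)\<in>\<N>. polyhedron S \<and> quadratic p" by blast
    qed
    show "zeta f h x \<le> ereal (p x)" if "(S, p) \<in> \<N>" "x \<in> S" for S p x
    proof -
      from that(1) obtain i v \<beta> where i: "i \<in> {1..T}" "(S, v, \<beta>) \<in> \<P> i"
        "p = (\<lambda>x. v \<bullet> x + \<beta> + R i x + k x)"
        unfolding \<N>_def by auto
      have "f x \<le> \<Psi> i x + ereal (R i x)"
        unfolding f R_def using i(1) by (intro Min_le) auto
      then have "f x \<le> ereal (v \<bullet> x + \<beta> + R i x)" using \<P>(3)[OF i(1,2) that(2)] by simp
      then have "f x + ereal (k x) \<le> ereal (v \<bullet> x + \<beta> + R i x) + ereal (k x)" by (rule add_right_mono)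
      then show ?thesis by (simp add: zeta_def k i(3))
    qed
    show "\<exists>(S, p)\<in>\<N>. x \<in> S \<and> zeta f h x = ereal (p x)" if fin: "zeta f h x < \<infinity>" for x
    proof -
      have "f x \<in> (\<lambda>i. \<Psi> i x + ereal (R i x)) ` {1..T}"
        unfolding f R_def using \<open>1 \<le> T\<close> by (intro Min_in) auto
      then obtain i where i: "i \<in> {1..T}" "f x = \<Psi> i x + ereal (R i x)" by blast
      then have "\<Psi> i x < \<infinity>" using fin by (auto simp: zeta_def k)
      then obtain S v \<beta> where S: "(S, v, \<beta>) \<in> \<P> i" "x \<in> S" using \<P>(5)[OF i(1)] by blast
      then have val: "zeta f h x = ereal (v \<bullet> x + \<beta> + R i x + k x)"
        using \<P>(3)[OF i(1) S] by (simp add: zeta_def k i(2))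
      have "(S, \<lambda>x. v \<bullet> x + \<beta> + R i x + k x) \<in> \<N>"
        unfolding \<N>_def using i(1) S(1) by force
      then show ?thesis by (rule bexI[rotated]) (simp add: val S(2))
    qed
  qed
qed

text \<open>The common interface of the two cases for \<open>g\<close>. Its last clause asks for
  Fenchel equality at every \<open>x\<close>, which makes \<open>Q\<close> proper.\<close>

definition conjugate_quadratic :: "('a::euclidean_space \<Rightarrow> ereal) \<Rightarrow> bool" where
  "conjugate_quadratic g \<longleftrightarrow>
     (\<exists>\<D>. quadratic_pieces \<D> \<and> (\<forall>(S, p)\<in>\<D>. \<forall>x\<in>S. g x = ereal (p x)) \<and> (\<forall>x. g x < \<infinity> \<longrightarrow> (\<exists>(S, p)\<in>\<D>. x \<in> S))) \<and>
     (\<exists>\<D>. quadratic_pieces \<D> \<and> (\<forall>(S, p)\<in>\<D>. \<forall>y\<in>S. conjugate g y = ereal (p y)) \<and>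
        (\<forall>y. conjugate g y < \<infinity> \<longrightarrow> (\<exists>(S, p)\<in>\<D>. y \<in> S))) \<and>
     (\<forall>x. \<exists>y. conjugate g y < \<infinity> \<and> eta g x y = g x)"

lemma affine_pieces_quadratic:
  assumes "affine_pieces \<psi> \<P>"
  shows "\<exists>\<D>. quadratic_pieces \<D> \<and> (\<forall>(S, p)\<in>\<D>. \<forall>x\<in>S. \<psi> x = ereal (p x)) \<and>
    (\<forall>x. \<psi> x < \<infinity> \<longrightarrow> (\<exists>(S, p)\<in>\<D>. x \<in> S))"
proof (intro exI conjI)
  let ?\<D> = "(\<lambda>(S, v, \<beta>). (S, \<lambda>x. v \<bullet> x + \<beta>)) ` \<P>"
  note D = affine_piecesD[OF assms]
  show "quadratic_pieces ?\<D>"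
    using D(1,2) by (auto simp: quadratic_pieces_def quadratic_affine)
  show "\<forall>(S, p)\<in>?\<D>. \<forall>x\<in>S. \<psi> x = ereal (p x)" using D(3) by auto
  show "\<forall>x. \<psi> x < \<infinity> \<longrightarrow> (\<exists>(S, p)\<in>?\<D>. x \<in> S)"
  proof (intro allI impI)
    fix x assume "\<psi> x < \<infinity>"
    then obtain S v \<beta> where S: "(S, v, \<beta>) \<in> \<P>" "x \<in> S" using D(5) by blast
    have "(S, \<lambda>x. v \<bullet> x + \<beta>) \<in> ?\<D>" by (rule image_eqI[OF _ S(1)]) simp
    then show "\<exists>(S, p)\<in>?\<D>. x \<in> S" using S(2) by blast
  qed
qed

lemma polyhedral_conjugate_quadratic:
  fixes g :: "'a::euclidean_space \<Rightarrow> ereal"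
  assumes "polyhedral_function g" and real: "\<And>x. \<bar>g x\<bar> \<noteq> \<infinity>"
  shows "conjugate_quadratic g"
proof -
  have ninf: "g x \<noteq> - \<infinity>" "g x < \<infinity>" for x using real[of x] by auto
  obtain \<P> where \<P>: "affine_pieces g \<P>"
    by (rule polyhedral_function_pieces[OF assms(1) ninf(1)]) (rule that)
  note gD = affine_piecesD[OF \<P>]
  \<comment> \<open>An affine minorant \<open>v \<bullet> x + \<beta>\<close> has conjugate value
    \<open>- \<beta>\<close> at its slope \<open>v\<close>, hence the sign.\<close>
  define A where "A = (\<lambda>(S, v, \<beta>). (v, - \<beta>)) ` \<P>"
  have A: "finite A" using gD(1) by (simp add: A_def)
  have A_minorant: "ereal (v \<bullet> x - t) \<le> g x" if "(v, t) \<in> A" for v t x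
    using that gD(4) by (auto simp: A_def)
  have A_active: "\<exists>(v, t)\<in>A. g x = ereal (v \<bullet> x - t)" for x
  proof -
    obtain S v \<beta> where S: "(S, v, \<beta>) \<in> \<P>" "x \<in> S" using gD(5)[OF ninf(2)] by blast
    then have "(v, - \<beta>) \<in> A" by (force simp: A_def)
    moreover have "g x = ereal (v \<bullet> x - - \<beta>)" using gD(3)[OF S] by simp
    ultimately show ?thesis by blast
  qed
  note hull = conjugate_max_affine_hull[OF A A_minorant A_active]
  obtain \<P>' where \<P>': "affine_pieces (conjugate g) \<P>'"
    by (rule polyhedral_lower_envelope[OF polyhedron_convex_hull[OF A] hull]) (assumption | rule that)+
  have "\<exists>y. conjugate g y < \<infinity> \<and> eta g x y = g x" for x
  proof -
    obtain v t where vt: "(v, t) \<in> A" "g x = ereal (v \<bullet> x - t)" using A_active[of x] by blast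
    have g: "g z = ereal (real_of_ereal (g z))" for z using real[of z] by (simp add: ereal_real)
    have "real_of_ereal (g x) + v \<bullet> (z - x) \<le> real_of_ereal (g z)" for z
    proof -
      have "ereal (v \<bullet> z - t) \<le> ereal (real_of_ereal (g z))" using A_minorant[OF vt(1), of z] g[of z] by simp
      then show ?thesis by (simp add: vt(2) inner_diff)
    qed
    from eta_at_subgradient[of g "\<lambda>z. real_of_ereal (g z)", OF g this] show ?thesis by blast
  qed
  then show ?thesis
    unfolding conjugate_quadratic_def
    using affine_pieces_quadratic[OF \<P>] affine_pieces_quadratic[OF \<P>'] ninf(2) by simp
qed

text \<open>The gap in the subgradient inequality is half the form at \<open>z - x\<close>. So
  \<open>z\<close> attains the supremum at slope \<open>q + P *v z\<close>. At a slope outside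
  \<open>q\<close> plus the range of \<open>P\<close>, a direction orthogonal to that range makes
  \<open>g\<close> affine along a line with the wrong slope, and the supremum is infinite.\<close>

lemma psd_conjugate_value:
  fixes P :: "real ^ 'n ^ 'n"
  assumes sym: "symmetric P" and psd: "\<And>x. 0 \<le> x \<bullet> (P *v x)"
    and g: "\<And>x. g x = ereal (quadratic_form P q s x)"
  shows "\<And>z x. quadratic_form P q s x + (q + P *v x) \<bullet> (z - x) \<le> quadratic_form P q s z"
    and "conjugate g (q + P *v z) = ereal (1/2 * (z \<bullet> (P *v z)) - s)"
    and "conjugate g y < \<infinity> \<Longrightarrow> y - q \<in> range ((*v) P)"
proof -
  have selfadj: "x \<bullet> (P *v z) = z \<bullet> (P *v x)" for x z
    using sym dot_lmul_matrix[of z P x] by (simp add: symmetric_def inner_commute flip: transpose_matrix_vector)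
  show sub: "quadratic_form P q s x + (q + P *v x) \<bullet> (z - x) \<le> quadratic_form P q s z" for x z
  proof -
    have "quadratic_form P q s z - (quadratic_form P q s x + (q + P *v x) \<bullet> (z - x))
        = 1/2 * ((z - x) \<bullet> (P *v (z - x)))"
      using selfadj[of x z]
      by (simp add: quadratic_form_def inner_add inner_diff matrix_vector_mult_diff_distrib
          inner_commute[of "P *v x"] algebra_simps)
    then show ?thesis using psd[of "z - x"] by linarith
  qed
  show "conjugate g (q + P *v z) = ereal (1/2 * (z \<bullet> (P *v z)) - s)"
  proof (rule antisym)
    have val: "z \<bullet> (q + P *v z) - quadratic_form P q s z = 1/2 * (z \<bullet> (P *v z)) - s"
      by (simp add: quadratic_form_def inner_add inner_commute)
    show "ereal (1/2 * (z \<bullet> (P *v z)) - s) \<le> conjugate g (q + P *v z)"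
      using conjugate_ge[of z "q + P *v z" g] val by (simp add: g)
    show "conjugate g (q + P *v z) \<le> ereal (1/2 * (z \<bullet> (P *v z)) - s)"
      unfolding conjugate_le_iff val[symmetric] g
    proof
      fix x
      show "ereal (x \<bullet> (q + P *v z)) - ereal (quadratic_form P q s x)
          \<le> ereal (z \<bullet> (q + P *v z) - quadratic_form P q s z)"
        using sub[of z x] by (simp add: inner_diff inner_commute)
    qed
  qed
  assume fin: "conjugate g y < \<infinity>"
  let ?L = "range ((*v) P)"
  have L: "subspace ?L" by (intro linear_subspace_image matrix_vector_mul_linear subspace_UNIV)
  obtain R where R: "\<And>x. R x \<in> ?L" "\<And>x z. z \<in> ?L \<Longrightarrow> R x \<bullet> z = x \<bullet> z"
    by (rule orthogonal_projection_exists[OF L]) (rule that)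
  define w where "w = (y - q) - R (y - q)"
  have orth: "w \<bullet> z = 0" if "z \<in> ?L" for z using R(2)[OF that] by (simp add: w_def inner_diff)
  have "w \<bullet> w = w \<bullet> (y - q)" using orth[OF R(1)[of "y - q"]] by (simp add: w_def inner_diff)
  have "w = 0"
  proof (rule ccontr)
    assume "w \<noteq> 0"
    then have pos: "0 < w \<bullet> w" by simp
    have "g 0 = ereal s" by (simp add: g quadratic_form_def)
    then have "conjugate g y \<noteq> - \<infinity>" using conjugate_ge[of 0 y g] by auto
    then obtain c where c: "conjugate g y = ereal c" using fin by (cases "conjugate g y") auto
    \<comment> \<open>The quadratic term vanishes along \<open>w\<close>; this \<open>k\<close>
      makes the value at \<open>k *\<^sub>R w\<close> exactly \<open>c + 1\<close>, above the
      supposed supremum \<open>c\<close>.\<close>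
    define k where "k = (c + s + 1) / (w \<bullet> w)"
    have "quadratic_form P q s (k *\<^sub>R w) = k * (q \<bullet> w) + s"
      using orth[of "P *v w"] by (simp add: quadratic_form_def matrix_vector_mult_scaleR)
    moreover have "k * (w \<bullet> y) - k * (q \<bullet> w) = c + s + 1"
    proof -
      have "k * (w \<bullet> y) - k * (q \<bullet> w) = k * (w \<bullet> w)"
        using \<open>w \<bullet> w = w \<bullet> (y - q)\<close>
        by (simp add: inner_diff inner_commute right_diff_distrib)
      also have "\<dots> = c + s + 1" using \<open>w \<noteq> 0\<close> by (simp add: k_def)
      finally show ?thesis .
    qed
    ultimately have "k * (w \<bullet> y) - quadratic_form P q s (k *\<^sub>R w) = c + 1" by linarith
    moreover have "k * (w \<bullet> y) - quadratic_form P q s (k *\<^sub>R w) \<le> c"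
      using conjugate_ge[of "k *\<^sub>R w" y g] by (simp add: g c)
    ultimately show False by simp
  qed
  then have "y - q = R (y - q)" by (simp add: w_def)
  then show "y - q \<in> ?L" using R(1)[of "y - q"] by simp
qed

lemma psd_conjugate_quadratic:
  assumes "psd_quadratic_function g"
  shows "conjugate_quadratic g"
proof -
  obtain P q s where P: "symmetric P" "\<And>x. 0 \<le> x \<bullet> (P *v x)"
    and g: "\<And>x. g x = ereal (quadratic_form P q s x)"
    using assms unfolding psd_quadratic_function_def by auto
  note conj = psd_conjugate_value[OF P g]
  obtain M where M: "linear M" "\<And>v. v \<in> range ((*v) P) \<Longrightarrow> P *v (M v) = v"
    using linear_exists_right_inverse_on[OF matrix_vector_mul_linear[of P] subspace_UNIV] by auto
  \<comment> \<open>Substitutes \<open>z = M (y - q)\<close> into the conjugate value at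
    \<open>q + P *v z\<close>. The sums with \<open>- q\<close> and \<open>0 \<bullet> y\<close> fit
    the affine closure lemmas.\<close>
  define p where "p y = 1/2 * ((y + - q) \<bullet> M (y + - q)) + (0 \<bullet> y + - s)" for y
  define S where "S = {y. y + - q \<in> range ((*v) P)}"
  have "quadratic p"
    unfolding p_def
    by (intro quadratic_add quadratic_scale quadratic_affine
        quadratic_compose_affine[OF quadratic_inner_linear[OF M(1)] linear_ident])
  moreover have "polyhedron S"
    unfolding S_def
    by (intro polyhedron_affine_vimage[OF linear_ident] affine_imp_polyhedron subspace_imp_affine
        linear_subspace_image matrix_vector_mul_linear subspace_UNIV)
  moreover have "conjugate g y = ereal (p y)" if "y \<in> S" for y
  proof -
    have z: "P *v M (y - q) = y - q" using M(2)[of "y - q"] that by (simp add: S_def)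
    from conj(2)[of "M (y - q)"] show ?thesis by (simp add: z p_def inner_commute)
  qed
  moreover have "y \<in> S" if "conjugate g y < \<infinity>" for y
    using conj(3)[OF that] by (simp add: S_def)
  ultimately have "\<exists>\<D>. quadratic_pieces \<D> \<and> (\<forall>(S, p)\<in>\<D>. \<forall>y\<in>S. conjugate g y = ereal (p y)) \<and>
        (\<forall>y. conjugate g y < \<infinity> \<longrightarrow> (\<exists>(S, p)\<in>\<D>. y \<in> S))"
    by (intro exI[of _ "{(S, p)}"]) (simp add: quadratic_pieces_def)
  moreover have "\<exists>\<D>. quadratic_pieces \<D> \<and> (\<forall>(S, p)\<in>\<D>. \<forall>x\<in>S. g x = ereal (p x)) \<and>
        (\<forall>x. g x < \<infinity> \<longrightarrow> (\<exists>(S, p)\<in>\<D>. x \<in> S))"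
    by (intro exI[of _ "{(UNIV, quadratic_form P q s)}"])
      (simp add: quadratic_pieces_def quadratic_quadratic_form g)
  moreover have "\<exists>y. conjugate g y < \<infinity> \<and> eta g x y = g x" for x
    using eta_at_subgradient[of g "quadratic_form P q s", OF g conj(1)] by blast
  ultimately show ?thesis unfolding conjugate_quadratic_def by simp
qed

lemma eta_quadratic_pieces:
  assumes "quadratic_pieces \<D>"
  shows "quadratic_pieces ((\<lambda>(S, p). ({z. snd z \<in> S}, \<lambda>z. fst z \<bullet> snd z - p (snd z))) ` \<D>)"
proof -
  \<comment> \<open>Pairing \<open>z\<close> with \<open>(snd z, 0)\<close> gives
    \<open>fst z \<bullet> snd z\<close>: the duality pairing is a quadratic form on the product
    space, given by a map that is not self-adjoint.\<close>
  have lin: "linear (\<lambda>z::'a \<times> 'a. (snd z, 0::'a))" by (intro linearI) auto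
  have bil: "quadratic (\<lambda>z::'a \<times> 'a. fst z \<bullet> snd z)"
    using quadratic_inner_linear[OF lin] by (simp add: inner_prod_def)
  have "quadratic (\<lambda>z::'a \<times> 'a. fst z \<bullet> snd z - p (snd z))" if "(S, p) \<in> \<D>" for S p
    by (rule quadratic_diff[OF bil quadratic_compose_linear[OF quadratic_piecesD(3)[OF assms that] linear_snd]])
  moreover have "polyhedron {z::'a \<times> 'a. snd z \<in> S}" if "(S, p) \<in> \<D>" for S p
    using polyhedron_affine_vimage[OF linear_snd quadratic_piecesD(2)[OF assms that], of 0] by simp
  ultimately show ?thesis
    using quadratic_piecesD(1)[OF assms] unfolding quadratic_pieces_def by auto
qed

theorem proposition6p11:
  fixes f g h :: "real ^ 'n \<Rightarrow> ereal"
    and N T :: nat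
    and B :: "nat \<Rightarrow> 'n set"
    and fs :: "nat \<Rightarrow> real ^ 'n \<Rightarrow> ereal"
    and \<Psi> :: "nat \<Rightarrow> real ^ 'n \<Rightarrow> ereal"
    and P :: "nat \<Rightarrow> real ^ 'n ^ 'n"
    and q :: "nat \<Rightarrow> real ^ 'n"
    and s :: "nat \<Rightarrow> real"
  assumes "proper f" and "lsc f"
    and "proper g" and "lsc g"
    and "proper h" and "lsc h"
    and "Omega g \<noteq> {}"
    and "block_separable N B fs f"
    and "continuous_on (effdom f) f"
    and "\<forall>i\<in>{1..N}. \<exists>m::real. \<forall>x\<in>block_space (B i). ereal m \<le> fs i x"
    and "locally_lipschitz_differentiable_on h (Omega g)"
    and "\<forall>x. \<bar>g x\<bar> \<noteq> \<infinity>" and "convex_on UNIV (\<lambda>x. real_of_ereal (g x))" and "\<forall>x. 0 \<le> g x"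
    and "\<forall>x\<in>effdom f. 0 \<le> f x + h x"
    and "Omega g \<inter> effdom f \<noteq> {}"
    and "1 \<le> T"
    and "\<forall>i\<in>{1..T}. proper (\<Psi> i) \<and> lsc (\<Psi> i) \<and> polyhedral_function (\<Psi> i) \<and> symmetric (P i)"
    and "\<forall>x. f x = Min ((\<lambda>i. \<Psi> i x + ereal (quadratic_form (P i) (q i) (s i) x)) ` {1..T})"
    and "quadratic_function h"
    and "polyhedral_function g \<or> psd_quadratic_function g"
  shows "KL_function (F_obj f g h) (1/2) \<and> KL_function (Q_obj f g h) (1/2)"
proof -
  note g_real = assms(12)[rule_format] and g_nonneg = assms(14)[rule_format]
  have \<Psi>: "\<And>i. i \<in> {1..T} \<Longrightarrow> proper (\<Psi> i) \<and> polyhedral_function (\<Psi> i)" using assms(18) by blast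
  obtain \<N> where \<N>: "quadratic_pieces \<N>"
    "\<And>S p x. (S, p) \<in> \<N> \<Longrightarrow> x \<in> S \<Longrightarrow> zeta f h x \<le> ereal (p x)"
    "\<And>x. zeta f h x < \<infinity> \<Longrightarrow> \<exists>(S, p)\<in>\<N>. x \<in> S \<and> zeta f h x = ereal (p x)"
    by (rule zeta_quadratic_pieces[OF \<Psi> assms(17) assms(19)[rule_format] assms(20)])
      (assumption | rule that)+
  have "conjugate_quadratic g"
    using assms(21) polyhedral_conjugate_quadratic[of g] psd_conjugate_quadratic[of g] g_real by blast
  then obtain \<D> \<D>' where
    \<D>: "quadratic_pieces \<D>" "\<forall>(S, p)\<in>\<D>. \<forall>x\<in>S. g x = ereal (p x)"
      "\<forall>x. g x < \<infinity> \<longrightarrow> (\<exists>(S, p)\<in>\<D>. x \<in> S)" and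
    \<D>': "quadratic_pieces \<D>'" "\<forall>(S, p)\<in>\<D>'. \<forall>y\<in>S. conjugate g y = ereal (p y)"
      "\<forall>y. conjugate g y < \<infinity> \<longrightarrow> (\<exists>(S, p)\<in>\<D>'. y \<in> S)" and
    sub: "\<forall>x. \<exists>y. conjugate g y < \<infinity> \<and> eta g x y = g x"
    unfolding conjugate_quadratic_def by (elim conjE exE) (rule that)
  have h_real: "\<exists>r. h x = ereal r" for x using assms(20) unfolding quadratic_function_def by auto
  have zeta_fin: "zeta f h x < \<infinity> \<longleftrightarrow> x \<in> effdom f" for x
    using h_real[of x] by (cases "f x") (auto simp: zeta_def effdom_def)
  have g_pos: "0 < g x \<longleftrightarrow> x \<in> Omega g" for x
    using g_nonneg[of x] by (auto simp: Omega_def less_le)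
  obtain x\<^sub>1 where x\<^sub>1: "x\<^sub>1 \<in> Omega g" "x\<^sub>1 \<in> effdom f" using assms(16) by blast
  have "KL_function (F_obj f g h) (1/2)"
  proof (rule KL_half_quotient[where \<N> = \<N> and \<D> = \<D> and x\<^sub>1 = x\<^sub>1])
    show "F_obj f g h x = (if zeta f h x < \<infinity> \<and> \<bar>g x\<bar> \<noteq> \<infinity> \<and> 0 < g x then zeta f h x / g x else \<infinity>)" for x
      unfolding F_obj_def zeta_fin g_pos using g_real by (simp add: conj_commute)
    show "zeta f h x\<^sub>1 < \<infinity>" "\<bar>g x\<^sub>1\<bar> \<noteq> \<infinity>" "0 < g x\<^sub>1"
      unfolding zeta_fin g_pos using x\<^sub>1 g_real by simp_all
    show "g x = ereal (p x)" if "(S, p) \<in> \<D>" "x \<in> S" for S p x using \<D>(2) that by blast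
    show "\<exists>(S, p)\<in>\<D>. x \<in> S" if "\<bar>g x\<bar> \<noteq> \<infinity>" for x using \<D>(3) that by auto
  qed (rule \<N> \<D>(1) | assumption)+
  moreover have "KL_function (Q_obj f g h) (1/2)"
  proof -
    \<comment> \<open>Numerator polyhedra constrain only the first component and denominator
      polyhedra only the second; the functions couple the components solely through the inner
      product.\<close>
    define \<N>\<^sub>2 where "\<N>\<^sub>2 = (\<lambda>(S, p). ({z :: (real ^ 'n) \<times> (real ^ 'n). fst z \<in> S}, \<lambda>z :: (real ^ 'n) \<times> (real ^ 'n). p (fst z))) ` \<N>"
    define \<D>\<^sub>2 where "\<D>\<^sub>2 = (\<lambda>(S, p). ({z :: (real ^ 'n) \<times> (real ^ 'n). snd z \<in> S}, \<lambda>z. fst z \<bullet> snd z - p (snd z))) ` \<D>'"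
    have conj_ninf: "conjugate g y \<noteq> - \<infinity>" for y
      using conjugate_ge[of 0 y g] g_real[of 0] by auto
    have eta_real: "\<bar>eta g x y\<bar> \<noteq> \<infinity> \<longleftrightarrow> y \<in> effdom (conjugate g)" for x y
      using conj_ninf[of y] by (cases "conjugate g y") (auto simp: eta_def effdom_def)
    \<comment> \<open>Fenchel equality at a feasible \<open>x\<^sub>1\<close> gives
      \<open>eta g x\<^sub>1 y\<^sub>1 = g x\<^sub>1 > 0\<close>, so \<open>Q\<close> is finite at
      this pair.\<close>
    obtain y\<^sub>1 where y\<^sub>1: "conjugate g y\<^sub>1 < \<infinity>" "eta g x\<^sub>1 y\<^sub>1 = g x\<^sub>1" using sub by blast
    show ?thesis
    proof (rule KL_half_quotient[where \<N> = \<N>\<^sub>2 and \<D> = \<D>\<^sub>2 and x\<^sub>1 = "(x\<^sub>1, y\<^sub>1)"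
          and \<zeta> = "\<lambda>z. zeta f h (fst z)" and \<rho> = "\<lambda>z. eta g (fst z) (snd z)"])
      show "Q_obj f g h z = (if zeta f h (fst z) < \<infinity> \<and> \<bar>eta g (fst z) (snd z)\<bar> \<noteq> \<infinity> \<and>
          0 < eta g (fst z) (snd z) then zeta f h (fst z) / eta g (fst z) (snd z) else \<infinity>)" for z
        unfolding Q_obj_def zeta_fin eta_real by (cases z) simp
      show "zeta f h (fst (x\<^sub>1, y\<^sub>1)) < \<infinity>" "\<bar>eta g (fst (x\<^sub>1, y\<^sub>1)) (snd (x\<^sub>1, y\<^sub>1))\<bar> \<noteq> \<infinity>"
        "0 < eta g (fst (x\<^sub>1, y\<^sub>1)) (snd (x\<^sub>1, y\<^sub>1))"
        unfolding zeta_fin fst_conv snd_conv y\<^sub>1(2) g_pos using x\<^sub>1 g_real by simp_all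
      show "quadratic_pieces \<N>\<^sub>2"
        unfolding \<N>\<^sub>2_def by (rule quadratic_pieces_compose_linear[OF \<N>(1) linear_fst])
      show "quadratic_pieces \<D>\<^sub>2" unfolding \<D>\<^sub>2_def by (rule eta_quadratic_pieces[OF \<D>'(1)])
      show "zeta f h (fst z) \<le> ereal (p z)" if "(S, p) \<in> \<N>\<^sub>2" "z \<in> S" for S p z
        using that \<N>(2) unfolding \<N>\<^sub>2_def by auto
      show "\<exists>(S, p)\<in>\<N>\<^sub>2. z \<in> S \<and> zeta f h (fst z) = ereal (p z)" if fin: "zeta f h (fst z) < \<infinity>" for z
      proof -
        obtain S p where S: "(S, p) \<in> \<N>" "fst z \<in> S" "zeta f h (fst z) = ereal (p (fst z))"
          using \<N>(3)[OF fin] by blast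
        have "({z. fst z \<in> S}, \<lambda>z. p (fst z)) \<in> \<N>\<^sub>2"
          unfolding \<N>\<^sub>2_def by (rule image_eqI[OF _ S(1)]) simp
        then show ?thesis by (rule bexI[rotated]) (use S in simp)
      qed
      show "eta g (fst z) (snd z) = ereal (p z)" if mem: "(S, p) \<in> \<D>\<^sub>2" "z \<in> S" for S p z
      proof -
        obtain S' p' where "(S', p') \<in> \<D>'" "snd z \<in> S'" "p z = fst z \<bullet> snd z - p' (snd z)"
          using mem unfolding \<D>\<^sub>2_def by auto
        moreover from this \<D>'(2) have "conjugate g (snd z) = ereal (p' (snd z))" by blast
        ultimately show ?thesis by (simp add: eta_def)
      qed
      show "\<exists>(S, p)\<in>\<D>\<^sub>2. z \<in> S" if fin: "\<bar>eta g (fst z) (snd z)\<bar> \<noteq> \<infinity>" for z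
      proof -
        have "conjugate g (snd z) < \<infinity>" using fin by (simp add: eta_real effdom_def)
        then obtain S p where S: "(S, p) \<in> \<D>'" "snd z \<in> S" using \<D>'(3) by blast
        have "({z. snd z \<in> S}, \<lambda>z. fst z \<bullet> snd z - p (snd z)) \<in> \<D>\<^sub>2"
          unfolding \<D>\<^sub>2_def by (rule image_eqI[OF _ S(1)]) simp
        then show ?thesis by (rule bexI[rotated]) (use S in simp)
      qed
    qed
  qed
  ultimately show ?thesis ..
qed

end
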